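(* Let $\mathcal{F}$ be a family of $n$ circles in the plane such that every two circles of $\mathcal{F}$ intersect, and suppose the arrangement $\mathcal{A}(\mathcal{F})$ is simple and non-trivial. Then $\mathcal{A}(\mathcal{F})$ has at most $2n-2$ digons.
   Context: The arrangement $\mathcal{A}(\mathcal{F})$ of a finite family $\mathcal{F}$ of circles is the cell complex into which the plane is decomposed by the circles, consisting of vertices (intersection points), edges (arcs between vertices) and faces. The arrangement is trivial if there are two points that lie on every circle of $\mathcal{F}$, and simple if no point lies on three circles of $\mathcal{F}$. A digon is a face of $\mathcal{A}(\mathcal{F})$ whose boundary consists of exactly two edges. *)

theory Defs
  imports "HOL-Analysis.Analysis"
begin

text \<open>The Euclidean plane is modelled by the type of complex numbers, with its usual distance.\<close>

definition is_circle :: "complex set \<Rightarrow> bool" where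
  "is_circle C \<longleftrightarrow> (\<exists>c r. r > 0 \<and> C = sphere c r)"

definition vertices :: "complex set set \<Rightarrow> complex set" where
  "vertices F = {p. \<exists>A\<in>F. \<exists>B\<in>F. A \<noteq> B \<and> p \<in> A \<and> p \<in> B}"

text \<open>Edges and faces are taken without their endpoints and boundaries, respectively.
  An edge is thus an open arc of a circle between consecutive vertices; if a circle contains only
  one vertex, its single edge is the circle minus that vertex.  The unbounded face is included.\<close>

definition edges :: "complex set set \<Rightarrow> complex set set" where
  "edges F = (\<Union>C\<in>F. components (C - vertices F))"

definition faces :: "complex set set \<Rightarrow> complex set set" where
  "faces F = components (- \<Union>F)"

definition digons :: "complex set set \<Rightarrow> complex set set" where
  "digons F = {f \<in> faces F. \<exists>e\<^sub>1\<in>edges F. \<exists>e\<^sub>2\<in>edges F.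
     e\<^sub>1 \<noteq> e\<^sub>2 \<and> frontier f = closure e\<^sub>1 \<union> closure e\<^sub>2}"

definition trivial_arrangement :: "complex set set \<Rightarrow> bool" where
  "trivial_arrangement F \<longleftrightarrow> (\<exists>p q. p \<noteq> q \<and> (\<forall>C\<in>F. p \<in> C \<and> q \<in> C))"

definition simple_arrangement :: "complex set set \<Rightarrow> bool" where
  "simple_arrangement F \<longleftrightarrow>
     \<not> (\<exists>p. \<exists>A\<in>F. \<exists>B\<in>F. \<exists>C\<in>F. A \<noteq> B \<and> A \<noteq> C \<and> B \<noteq> C \<and> p \<in> A \<and> p \<in> B \<and> p \<in> C)"

end

theory Submission imports Defs begin

text \<open>
  Lift the circles to the unit sphere by stereographic projection.  If $n \geq 3$, a digon with
  edges on two circles is a lens, the intersection of two open caps, whose closure is disjoint from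
  all other circles.  All digons at one circle lie on the same side of it, so every circle
  determines one cap, with a centre on the sphere.  Join the centre $a$ of one cap of a digon to
  the antipode $-b$ of the centre of the other cap, and $-a$ to $b$, by great-circle arcs.  These
  arcs do not cross: at a crossing point, comparing how deep the point lies in the four caps gives
  contradictory inequalities, because the lenses miss the other circles.  So $e$ digons give a
  bipartite plane graph with $2n$ vertices and $2e$ edges, hence $2e \leq 2 (2n) - 4$
  (the proof gives $2 (2n) - 3$, which suffices by parity).

  Instead of Euler's formula, the edge bound is obtained by sweeping with a meridian about a
  generic pole and charging the angles between consecutive arcs to vertices.
\<close>

section \<open>Non-crossing arcs on the sphere\<close>

text \<open>The antipodes are what makes crossings tractable. A common point of the arcs from a to
  -b and from g to -d satisfies \<alpha> a - \<beta> b = \<gamma> g - \<delta> d with nonnegative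
  coefficients. Moving the negative terms across gives a point shared by the segments ad and gb,
  which join centres of caps whose boundary circles meet; so the two depths of the point in the caps
  at the ends of a segment (radius minus distance to the centre) have a nonnegative sum. Few circles
  need separate care. Circles may touch, so a face can be bounded by a single circle with two points
  of tangency. This is a digon but no lens, and it occurs only for n = 3. Two circles are
  non-trivial only if they are tangent. Both cases are counted directly.\<close>

definition cr :: "complex \<Rightarrow> complex \<Rightarrow> real" where
  "cr a b = Re a * Im b - Im a * Re b"

lemma cr_self [simp]: "cr a a = 0" by (simp add: cr_def)
lemma cr_anti: "cr a b = - cr b a" by (simp add: cr_def)
lemma cr_add1: "cr (a + b) c = cr a c + cr b c" by (simp add: cr_def algebra_simps)
lemma cr_add2: "cr c (a + b) = cr c a + cr c b" by (simp add: cr_def algebra_simps)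
lemma cr_sc1 [simp]: "cr (of_real k * a) c = k * cr a c" by (simp add: cr_def algebra_simps)
lemma cr_sc2 [simp]: "cr c (of_real k * a) = k * cr c a" by (simp add: cr_def algebra_simps)
lemma cr_uminus1 [simp]: "cr (- a) c = - cr a c" by (simp add: cr_def)
lemma cr_uminus2 [simp]: "cr c (- a) = - cr c a" by (simp add: cr_def)
lemma cr_cnj [simp]: "cr (cnj a) (cnj b) = cr b a" by (simp add: cr_def)

text \<open>The three-term Pluecker relation of four plane vectors. Being east of a direction by
  less than half a turn is not transitive, so the two lemmas below compare directions through the
  signs of the products on the right.\<close>

lemma cr_ptolemy: "cr a c * cr b d = cr a b * cr c d + cr a d * cr b c"
  by (simp add: cr_def algebra_simps)

lemma cr_outer_pos:
  assumes "0 < cr b d" "0 < cr a b * cr c d + cr a d * cr b c"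
  shows "0 < cr a c"
  using assms cr_ptolemy[of a c b d] by (metis zero_less_mult_pos2)

lemma cr_inner_pos:
  assumes "0 < cr a c" "0 < cr a b * cr c d + cr a d * cr b c"
  shows "0 < cr b d"
  using assms cr_ptolemy[of a c b d] by (metis zero_less_mult_pos)

text \<open>\<open>g u\<close> is the cotangent of the angle from \<open>t\<close> to
  \<open>f u\<close>, which decreases between 0 and \<pi>. Its maximum is the direction met first
  when turning east from \<open>t\<close>.\<close>

lemma cr_east_most:
  assumes "finite Q" "Q \<noteq> {}" and pos: "\<And>u. u \<in> Q \<Longrightarrow> 0 < cr t (f u)"
  shows "\<exists>u\<in>Q. \<forall>u'\<in>Q. 0 \<le> cr (f u) (f u')"
proof -
  define g where "g u = (Re t * Re (f u) + Im t * Im (f u)) / cr t (f u)" for u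
  have "finite (g ` Q)" "g ` Q \<noteq> {}" using assms by auto
  then have "Max (g ` Q) \<in> g ` Q" by (rule Max_in)
  then obtain u where u0: "u \<in> Q" "Max (g ` Q) = g u" by blast
  have u: "u \<in> Q" "\<And>u'. u' \<in> Q \<Longrightarrow> g u' \<le> g u"
    using u0 Max_ge[OF \<open>finite (g ` Q)\<close>] by (auto simp flip: u0(2))
  have "0 \<le> cr (f u) (f u')" if u': "u' \<in> Q" for u'
  proof -
    have p: "0 < cr t (f u)" "0 < cr t (f u')" using pos u u' by auto
    have "0 \<le> g u - g u'" using u(2)[OF u'] by simp
    also have "g u - g u' = ((Re t)\<^sup>2 + (Im t)\<^sup>2) * cr (f u) (f u') / (cr t (f u) * cr t (f u'))"
    proof -
      have n: "cr t (f u) \<noteq> 0" "cr t (f u') \<noteq> 0" using p by auto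
      have "(Re t * Re (f u) + Im t * Im (f u)) * cr t (f u') - (Re t * Re (f u') + Im t * Im (f u')) * cr t (f u)
        = ((Re t)\<^sup>2 + (Im t)\<^sup>2) * cr (f u) (f u')"
        by (simp add: cr_def algebra_simps power2_eq_square)
      then show ?thesis unfolding g_def diff_frac_eq[OF n] by simp
    qed
    finally have "0 \<le> ((Re t)\<^sup>2 + (Im t)\<^sup>2) * cr (f u) (f u')"
      using mult_pos_pos[OF p] by (simp add: zero_le_divide_iff)
    moreover have "0 < (Re t)\<^sup>2 + (Im t)\<^sup>2"
    proof -
      have "t \<noteq> 0" using p by (auto simp: cr_def)
      then show ?thesis by (metis complex_eq_iff sum_power2_gt_zero_iff zero_complex.sel)
    qed
    ultimately show ?thesis by (simp add: zero_le_mult_iff)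
  qed
  then show ?thesis using u(1) by blast
qed

text \<open>A vertex is the vector $(z, h) \in \mathbb{C} \times \mathbb{R}$, seen from the origin; the poles
  are $(0, \pm 1)$, and \<open>(p, q) \<in> R\<close> is an arc running eastwards from \<open>p\<close> to \<open>q\<close>, spanning less than half
  a turn.  The quotient in \<open>noncross\<close> is the height at which an arc passes over the direction
  \<open>t\<close>: it is linear in \<open>t\<close>, so arcs behave like straight segments.\<close>

locale arcs =
  fixes V :: "'v set" and z :: "'v \<Rightarrow> complex" and h :: "'v \<Rightarrow> real" and R :: "('v \<times> 'v) set"
  assumes finV: "finite V"
    and R_sub: "R \<subseteq> V \<times> V"
    and R_pos: "\<And>p q. (p, q) \<in> R \<Longrightarrow> 0 < cr (z p) (z q)"
    and incident: "\<And>v. v \<in> V \<Longrightarrow> \<exists>u. (u, v) \<in> R \<or> (v, u) \<in> R"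
    and parallel: "\<And>p q. p \<in> V \<Longrightarrow> q \<in> V \<Longrightarrow> p \<noteq> q \<Longrightarrow> cr (z p) (z q) = 0 \<Longrightarrow>
        \<exists>k>0. z q = - (of_real k * z p)"
    and east: "\<And>v. v \<in> V \<Longrightarrow> \<exists>d\<in>V. 0 < cr (z v) (z d)"
    and west: "\<And>v. v \<in> V \<Longrightarrow> \<exists>d\<in>V. 0 < cr (z d) (z v)"
    and noncross: "\<And>p q r s t. (p, q) \<in> R \<Longrightarrow> (r, s) \<in> R \<Longrightarrow> (p, q) \<noteq> (r, s) \<Longrightarrow> t \<noteq> 0 \<Longrightarrow>
        0 \<le> cr (z p) t \<Longrightarrow> 0 \<le> cr t (z q) \<Longrightarrow> 0 \<le> cr (z r) t \<Longrightarrow> 0 \<le> cr t (z s) \<Longrightarrow>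
        (cr t (z q) * h p + cr (z p) t * h q) / cr (z p) (z q) =
        (cr t (z s) * h r + cr (z r) t * h s) / cr (z r) (z s) \<Longrightarrow>
        \<exists>v\<in>{p, q} \<inter> {r, s}. cr (z v) t = 0"
    and no_triangle: "\<And>p q r. (p, q) \<in> R \<Longrightarrow> (q, r) \<in> R \<Longrightarrow> (p, r) \<notin> R"
begin

definition L :: "'v \<Rightarrow> 'v \<Rightarrow> complex \<Rightarrow> real" where
  "L p q t = (cr t (z q) * h p + cr (z p) t * h q) / cr (z p) (z q)"

lemma inV: "(p, q) \<in> R \<Longrightarrow> p \<in> V" "(p, q) \<in> R \<Longrightarrow> q \<in> V"
  using R_sub by auto

lemma finR: "finite R"
  using R_sub finV by (meson finite_SigmaI finite_subset)

lemma L_ends: "(p, q) \<in> R \<Longrightarrow> L p q (z p) = h p" "(p, q) \<in> R \<Longrightarrow> L p q (z q) = h q"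
  using R_pos[of p q] by (auto simp: L_def)

lemma L_lin: "L p q (of_real a * s + of_real b * t) = a * L p q s + b * L p q t"
proof -
  have "cr (of_real a * s + of_real b * t) (z q) * h p + cr (z p) (of_real a * s + of_real b * t) * h q
    = a * (cr s (z q) * h p + cr (z p) s * h q) + b * (cr t (z q) * h p + cr (z p) t * h q)"
    unfolding cr_add1 cr_add2 cr_sc1 cr_sc2 by (simp add: algebra_simps)
  then show ?thesis unfolding L_def times_divide_eq_right add_divide_distrib[symmetric] by simp
qed

lemma same_dir:
  assumes "p \<in> V" "q \<in> V" "0 < cr t (z p)" "0 < cr t (z q)" "cr (z p) (z q) = 0"
  shows "p = q"
proof (rule ccontr)
  assume "p \<noteq> q"
  then obtain k where "k > 0" "z q = - (of_real k * z p)" using parallel assms by blast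
  then show False using assms by (simp add: mult_less_0_iff)
qed

text \<open>An intersection permitted by \<open>noncross\<close> lies over a common end vertex, but
  \<open>t\<close> is strictly between the ends of the first arc.\<close>

lemma touch:
  assumes "(p, q) \<in> R" "(r, s) \<in> R" "(p, q) \<noteq> (r, s)"
    and "0 < cr (z p) t" "0 < cr t (z q)" "0 \<le> cr (z r) t" "0 \<le> cr t (z s)"
  shows "L p q t \<noteq> L r s t"
proof
  assume "L p q t = L r s t"
  moreover have "t \<noteq> 0" using assms(4) by (auto simp: cr_def)
  ultimately obtain v where "v \<in> {p, q}" "cr (z v) t = 0"
    using noncross[OF assms(1-3), of t] assms(4-) unfolding L_def by auto
  then show False using assms(4,5) cr_anti[of "z q" t] by auto
qed

text \<open>Since \<open>noncross\<close> speaks only of arcs, the vertex is viewed as an end of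
  some arc provided by \<open>incident\<close>.\<close>

lemma vertex_off_arc:
  assumes "(p, q) \<in> R" "v \<in> V" "0 < cr (z p) (z v)" "0 < cr (z v) (z q)"
  shows "L p q (z v) \<noteq> h v"
proof -
  have ne: "v \<noteq> p" "v \<noteq> q" using assms by auto
  obtain u where "(u, v) \<in> R \<or> (v, u) \<in> R" using incident[OF assms(2)] by blast
  then show ?thesis
  proof
    assume uv: "(u, v) \<in> R"
    then have "L p q (z v) \<noteq> L u v (z v)"
      using touch[OF assms(1) uv _ assms(3,4)] ne R_pos[OF uv] by auto
    then show ?thesis using L_ends[OF uv] by simp
  next
    assume uv: "(v, u) \<in> R"
    then have "L p q (z v) \<noteq> L v u (z v)"
      using touch[OF assms(1) uv _ assms(3,4)] ne R_pos[OF uv] by auto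
    then show ?thesis using L_ends[OF uv] by simp
  qed
qed

text \<open>Both heights are linear, so a change of order between \<open>t\<close> and
  \<open>u\<close> forces equal heights over the combination \<open>s'\<close>, in which each
  direction is weighted by the height difference at the other one. The assumptions \<open>o\<close>
  make \<open>s'\<close> an interior direction of \<open>pq\<close>, so that \<open>touch\<close>
  applies.\<close>

lemma order_kept:
  assumes pq: "(p, q) \<in> R" and rs: "(r, s) \<in> R" and ne: "(p, q) \<noteq> (r, s)"
    and c1: "0 \<le> cr (z p) t" "0 \<le> cr t (z q)" "0 \<le> cr (z r) t" "0 \<le> cr t (z s)"
    and c2: "0 \<le> cr (z p) u" "0 \<le> cr u (z q)" "0 \<le> cr (z r) u" "0 \<le> cr u (z s)"
    and o: "0 < cr (z p) t \<or> 0 < cr (z p) u" "0 < cr t (z q) \<or> 0 < cr u (z q)"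
  shows "L p q t < L r s t \<Longrightarrow> L p q u \<le> L r s u" (is "?A \<Longrightarrow> ?B")
    and "L r s t < L p q t \<Longrightarrow> L r s u \<le> L p q u" (is "?C \<Longrightarrow> ?D")
proof -
  define D where "D t = L p q t - L r s t" for t
  have key: False if "D t * D u < 0"
  proof -
    define a b where "a = \<bar>D u\<bar>" and "b = \<bar>D t\<bar>"
    have ab: "0 < a" "0 < b" using that by (auto simp: a_def b_def mult_less_0_iff)
    define s' where "s' = of_real a * t + of_real b * u"
    have "D s' = a * D t + b * D u" unfolding s'_def D_def L_lin by (simp add: algebra_simps)
    also have "\<dots> = 0" using that by (auto simp: a_def b_def mult_less_0_iff)
    finally have eq: "L p q s' = L r s s'" by (simp add: D_def)
    have e: "cr v s' = a * cr v t + b * cr v u" "cr s' v = a * cr t v + b * cr u v" for v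
      by (auto simp: s'_def cr_add1 cr_add2)
    have "0 < cr (z p) s'" "0 < cr s' (z q)"
      unfolding e using c1 c2 o ab
      by (smt (verit) mult_pos_pos mult_nonneg_nonneg)+
    moreover have "0 \<le> cr (z r) s'" "0 \<le> cr s' (z s)"
      unfolding e using c1 c2 ab by auto
    ultimately show False using touch[OF pq rs ne] eq by blast
  qed
  then show "?A \<Longrightarrow> ?B" "?C \<Longrightarrow> ?D"
    by (force simp: D_def mult_less_0_iff)+
qed

section \<open>Neighbouring arcs of a vertex and wedges between arcs\<close>

definition Up :: "'v \<Rightarrow> 'v \<times> 'v \<Rightarrow> bool" where
  "Up w e \<longleftrightarrow> (\<exists>c d. e = (c, d) \<and> (c, d) \<in> R \<and> 0 < cr (z c) (z w) \<and> 0 < cr (z w) (z d) \<and> h w < L c d (z w) \<and>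
     (\<forall>c' d'. (c', d') \<in> R \<longrightarrow> 0 < cr (z c') (z w) \<longrightarrow> 0 < cr (z w) (z d') \<longrightarrow> h w < L c' d' (z w) \<longrightarrow>
        L c d (z w) \<le> L c' d' (z w)))"

definition Dn :: "'v \<Rightarrow> 'v \<times> 'v \<Rightarrow> bool" where
  "Dn w e \<longleftrightarrow> (\<exists>c d. e = (c, d) \<and> (c, d) \<in> R \<and> 0 < cr (z c) (z w) \<and> 0 < cr (z w) (z d) \<and> L c d (z w) < h w \<and>
     (\<forall>c' d'. (c', d') \<in> R \<longrightarrow> 0 < cr (z c') (z w) \<longrightarrow> 0 < cr (z w) (z d') \<longrightarrow> L c' d' (z w) < h w \<longrightarrow>
        L c' d' (z w) \<le> L c d (z w)))"

lemma Up_unique: "Up w e \<Longrightarrow> Up w e' \<Longrightarrow> e = e'"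
proof -
  assume a: "Up w e" "Up w e'"
  obtain c d where e: "e = (c, d)" by (cases e)
  obtain c' d' where e': "e' = (c', d')" by (cases e')
  have "L c d (z w) = L c' d' (z w)"
    using a unfolding Up_def e e' by (intro antisym) auto
  then show "e = e'"
    using a touch[of c d c' d' "z w"] unfolding Up_def e e' by fastforce
qed

lemma Dn_unique: "Dn w e \<Longrightarrow> Dn w e' \<Longrightarrow> e = e'"
proof -
  assume a: "Dn w e" "Dn w e'"
  obtain c d where e: "e = (c, d)" by (cases e)
  obtain c' d' where e': "e' = (c', d')" by (cases e')
  have "L c d (z w) = L c' d' (z w)"
    using a unfolding Dn_def e e' by (intro antisym) auto
  then show "e = e'"
    using a touch[of c d c' d' "z w"] unfolding Dn_def e e' by fastforce
qed

text \<open>The slope with which the arc leaves \<open>v\<close> eastwards: the formula is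
  \<open>L v x\<close> at \<open>\<i> * z v\<close>, a quarter turn east of
  \<open>v\<close>.\<close>

definition sl :: "'v \<Rightarrow> 'v \<Rightarrow> real" where
  "sl v x = (h x * ((Re (z v))\<^sup>2 + (Im (z v))\<^sup>2) - h v * (Re (z x) * Re (z v) + Im (z x) * Im (z v)))
            / cr (z v) (z x)"

lemma L_sl:
  assumes "(v, x) \<in> R"
  shows "((Re (z v))\<^sup>2 + (Im (z v))\<^sup>2) * L v x t =
    (Re t * Re (z v) + Im t * Im (z v)) * h v + cr (z v) t * sl v x"
proof -
  have n: "cr (z v) (z x) \<noteq> 0" using R_pos[OF assms] by simp
  let ?n = "(Re (z v))\<^sup>2 + (Im (z v))\<^sup>2"
  have "?n * (cr t (z x) * h v + cr (z v) t * h x) =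
    (Re t * Re (z v) + Im t * Im (z v)) * h v * cr (z v) (z x) +
     cr (z v) t * (h x * ?n - h v * (Re (z x) * Re (z v) + Im (z x) * Im (z v)))"
    by (simp add: cr_def algebra_simps power2_eq_square)
  then show ?thesis unfolding L_def sl_def times_divide_eq_right using n
    by (simp add: divide_eq_eq add_divide_eq_iff)
qed

lemma sl_less:
  assumes "(v, x) \<in> R" "(v, y) \<in> R" "0 < cr (z v) t"
  shows "sl v x < sl v y \<longleftrightarrow> L v x t < L v y t"
proof -
  let ?n = "(Re (z v))\<^sup>2 + (Im (z v))\<^sup>2"
  have n: "0 < ?n"
  proof -
    have "z v \<noteq> 0" using assms by (auto simp: cr_def)
    then show ?thesis by (metis complex_eq_iff sum_power2_gt_zero_iff zero_complex.sel)
  qed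
  have "L v x t < L v y t \<longleftrightarrow> ?n * L v x t < ?n * L v y t" using n by simp
  also have "\<dots> \<longleftrightarrow> sl v x < sl v y"
    unfolding L_sl[OF assms(1)] L_sl[OF assms(2)] using assms(3) by simp
  finally show ?thesis by simp
qed

text \<open>Two arcs that leave \<open>v\<close> with the same slope have equal heights throughout,
  so the nearer of their east ends would lie inside the other arc.\<close>

lemma sl_inj:
  assumes "(v, x) \<in> R" "(v, y) \<in> R" "sl v x = sl v y"
  shows "x = y"
proof (rule ccontr)
  assume ne: "x \<noteq> y"
  have px: "0 < cr (z v) (z x)" and py: "0 < cr (z v) (z y)" using R_pos assms by auto
  then have "cr (z x) (z y) \<noteq> 0" using same_dir ne inV assms by metis
  have eq: "L v x t = L v y t" if "0 < cr (z v) t" for t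
    using sl_less[OF assms(1,2) that] sl_less[OF assms(2,1) that] assms(3) by linarith
  consider "0 < cr (z x) (z y)" | "0 < cr (z y) (z x)"
    using \<open>cr (z x) (z y) \<noteq> 0\<close> cr_anti[of "z x" "z y"] by linarith
  then show False
  proof cases
    case 1
    then show False using vertex_off_arc[OF assms(2) _ px 1] inV assms L_ends eq[OF px] by metis
  next
    case 2
    then show False using vertex_off_arc[OF assms(1) _ py 2] inV assms L_ends eq[OF py] by metis
  qed
qed


text \<open>Here \<open>w\<close> is the first vertex east of \<open>v\<close> in the wedge between the consecutive arcs \<open>vy\<close>
  and \<open>vx\<close>; an arc inside the wedge just west of \<open>w\<close> would have to start in the wedge or at \<open>v\<close>.\<close>

lemma squeeze:
  assumes vx: "(v, x) \<in> R" and vy: "(v, y) \<in> R"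
    and consec: "\<And>x'. (v, x') \<in> R \<Longrightarrow> sl v y < sl v x' \<Longrightarrow> sl v x \<le> sl v x'"
    and w: "w \<in> V" "0 < cr (z v) (z w)" "0 \<le> cr (z w) (z x)" "0 \<le> cr (z w) (z y)"
    and first: "\<And>u. u \<in> V \<Longrightarrow> 0 < cr (z v) (z u) \<Longrightarrow> 0 \<le> cr (z u) (z x) \<Longrightarrow> 0 \<le> cr (z u) (z y) \<Longrightarrow>
      L v y (z u) \<le> h u \<Longrightarrow> h u \<le> L v x (z u) \<Longrightarrow> 0 \<le> cr (z w) (z u)"
    and cd: "(c, d) \<in> R" "0 < cr (z c) (z w)" "0 \<le> cr (z w) (z d)"
    and between: "L v y (z w) < L c d (z w)" "L c d (z w) < L v x (z w)"
  shows False
proof -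
  have px: "0 < cr (z v) (z x)" and py: "0 < cr (z v) (z y)" and pcd: "0 < cr (z c) (z d)"
    using R_pos vx vy cd by auto
  have cV: "c \<in> V" and vV: "v \<in> V" using inV cd vx by auto
  consider "0 < cr (z v) (z c)" | "c = v" | "cr (z v) (z c) \<le> 0" "c \<noteq> v" by linarith
  then show False
  proof cases
    case 1
    then have ne: "(c, d) \<noteq> (v, x)" "(c, d) \<noteq> (v, y)" by auto
    have cx: "0 < cr (z c) (z x)"
      by (rule cr_inner_pos[of "z v" "z w"]) (use w 1 cd px in \<open>auto intro!: add_nonneg_pos mult_pos_pos\<close>)
    have cy: "0 < cr (z c) (z y)"
      by (rule cr_inner_pos[of "z v" "z w"]) (use w 1 cd py in \<open>auto intro!: add_nonneg_pos mult_pos_pos\<close>)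
    have "L c d (z c) \<le> L v x (z c)"
      by (rule order_kept(1)[OF cd(1) vx ne(1), of "z w"]) (use w 1 cd cx pcd between in auto)
    moreover have "L v y (z c) \<le> L c d (z c)"
      by (rule order_kept(2)[OF cd(1) vy ne(2), of "z w"]) (use w 1 cd cy pcd between in auto)
    ultimately have "0 \<le> cr (z w) (z c)"
      using first[OF cV 1] cx cy L_ends(1)[OF cd(1)] by simp
    then show False using cd(2) cr_anti[of "z c" "z w"] by simp
  next
    case 2
    then have vd: "(v, d) \<in> R" using cd by simp
    have "sl v y < sl v d" "sl v d < sl v x"
      using sl_less[OF vy vd w(2)] sl_less[OF vd vx w(2)] between 2 by auto
    then show False using consec[OF vd] by simp
  next
    case 3
    have "cr (z v) (z c) \<noteq> 0"
    proof
      assume "cr (z v) (z c) = 0"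
      then obtain k where "k > 0" "z c = - (of_real k * z v)" using parallel[OF vV cV] 3 by auto
      then show False using cd(2) w(2) by (simp add: mult_less_0_iff)
    qed
    then have cv: "0 < cr (z c) (z v)" using 3 cr_anti[of "z c" "z v"] by simp
    have vd: "0 < cr (z v) (z d)"
      by (rule cr_inner_pos[of "z c" "z w"]) (use w cv cd pcd in \<open>auto intro!: add_nonneg_pos mult_pos_pos\<close>)
    have ne: "(v, x) \<noteq> (c, d)" "(v, y) \<noteq> (c, d)" using 3 by auto
    have "L c d (z v) \<le> L v x (z v)"
      by (rule order_kept(2)[OF vx cd(1) ne(1), of "z w"]) (use w cv vd cd px between in auto)
    moreover have "L v y (z v) \<le> L c d (z v)"
      by (rule order_kept(1)[OF vy cd(1) ne(2), of "z w"]) (use w cv vd cd py between in auto)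
    \<comment> \<open>Over \<open>v\<close> both bounding arcs have height \<open>h v\<close>, so
      the arc \<open>cd\<close> is forced through the vertex \<open>v\<close>, strictly between its
      own ends.\<close>
    ultimately have "L c d (z v) = h v" using L_ends(1)[OF vx] L_ends(1)[OF vy] by simp
    then show False using vertex_off_arc[OF cd(1) vV cv vd] by simp
  qed
qed

text \<open>A first vertex \<open>w\<close> of the closed wedge exists, since the nearer of
  \<open>x\<close> and \<open>y\<close> belongs to it. By \<open>squeeze\<close> no arc passes
  strictly between \<open>vy\<close> and \<open>vx\<close> over \<open>w\<close>, so
  \<open>vx\<close> is next above \<open>w\<close> and \<open>vy\<close> next below, unless one of
  them ends at \<open>w\<close>.\<close>

lemma wedge:
  assumes vy: "(v, y) \<in> R" and ex: "\<exists>x. (v, x) \<in> R \<and> sl v y < sl v x"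
  shows "\<exists>x. (v, x) \<in> R \<and> (Up y (v, x) \<or> Dn x (v, y) \<or>
    (\<exists>w\<in>V. Up w (v, x) \<and> Dn w (v, y) \<and> (\<forall>u. (u, w) \<notin> R)))"
proof -
  define X where "X = {x. (v, x) \<in> R \<and> sl v y < sl v x}"
  have "X \<subseteq> V" using inV by (auto simp: X_def)
  then have "finite X" "X \<noteq> {}" using finV finite_subset ex by (auto simp: X_def)
  then have fi: "finite (sl v ` X)" "sl v ` X \<noteq> {}" by auto
  then obtain x where x0: "x \<in> X" "Min (sl v ` X) = sl v x" using Min_in[OF fi] by blast
  have x: "x \<in> X" "\<And>x'. x' \<in> X \<Longrightarrow> sl v x \<le> sl v x'"
    using x0 Min_le[OF fi(1)] by (auto simp flip: x0(2))
  have vx: "(v, x) \<in> R" and lt: "sl v y < sl v x" using x by (auto simp: X_def)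
  have consec: "sl v x \<le> sl v x'" if "(v, x') \<in> R" "sl v y < sl v x'" for x'
    using that x(2) by (auto simp: X_def)
  have px: "0 < cr (z v) (z x)" and py: "0 < cr (z v) (z y)" using R_pos vx vy by auto
  have xV: "x \<in> V" and yV: "y \<in> V" and vV: "v \<in> V" using inV vx vy by auto
  have xy: "x \<noteq> y" using lt by auto
  define T where "T = {u \<in> V. 0 < cr (z v) (z u) \<and> 0 \<le> cr (z u) (z x) \<and> 0 \<le> cr (z u) (z y) \<and>
      L v y (z u) \<le> h u \<and> h u \<le> L v x (z u)}"
  have Ls: "L v y t < L v x t" if "0 < cr (z v) t" for t
    using sl_less[OF vy vx that] lt by simp
  have "x \<in> T \<or> y \<in> T"
    using Ls[OF px] Ls[OF py] L_ends(2)[OF vx] L_ends(2)[OF vy] px py xV yV cr_anti[of "z x" "z y"]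
    by (auto simp: T_def)
  then have "\<exists>w\<in>T. \<forall>u\<in>T. 0 \<le> cr (z w) (z u)"
    by (intro cr_east_most[where t = "z v"]) (use finV in \<open>auto simp: T_def\<close>)
  then obtain w where w: "w \<in> T" "\<And>u. u \<in> T \<Longrightarrow> 0 \<le> cr (z w) (z u)" by blast
  have w': "w \<in> V" "0 < cr (z v) (z w)" "0 \<le> cr (z w) (z x)" "0 \<le> cr (z w) (z y)"
    "L v y (z w) \<le> h w" "h w \<le> L v x (z w)" using w by (auto simp: T_def)
  have sq: False if "(c, d) \<in> R" "0 < cr (z c) (z w)" "0 \<le> cr (z w) (z d)"
    "L v y (z w) < L c d (z w)" "L c d (z w) < L v x (z w)" for c d
    by (rule squeeze[OF vx vy consec w'(1-4) _ that]) (use w(2) in \<open>auto simp: T_def\<close>)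
  have up: "h w < L v x (z w) \<and> Up w (v, x)" if "w \<noteq> x"
  proof -
    have wx: "0 < cr (z w) (z x)" using same_dir[OF w'(1) xV w'(2) px] that w'(3) by force
    then have lt: "h w < L v x (z w)" using vertex_off_arc[OF vx w'(1,2)] w'(6) by force
    have "L v x (z w) \<le> L c' d' (z w)" if "(c', d') \<in> R" "0 < cr (z c') (z w)" "0 < cr (z w) (z d')" "h w < L c' d' (z w)" for c' d'
      using sq[OF that(1,2)] that w'(5) by force
    then show ?thesis using lt wx w'(2) vx unfolding Up_def by blast
  qed
  have dn: "L v y (z w) < h w \<and> Dn w (v, y)" if "w \<noteq> y"
  proof -
    have wx: "0 < cr (z w) (z y)" using same_dir[OF w'(1) yV w'(2) py] that w'(4) by force
    then have lt: "L v y (z w) < h w" using vertex_off_arc[OF vy w'(1,2)] w'(5) by force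
    have "L c' d' (z w) \<le> L v y (z w)" if "(c', d') \<in> R" "0 < cr (z c') (z w)" "0 < cr (z w) (z d')" "L c' d' (z w) < h w" for c' d'
      using sq[OF that(1,2)] that w'(6) by force
    then show ?thesis using lt wx w'(2) vy unfolding Dn_def by blast
  qed
  consider "w = y" | "w = x" | "w \<noteq> x" "w \<noteq> y" by blast
  then show ?thesis
  proof cases
    case 1 then show ?thesis using up xy vx by auto
  next
    case 2 then show ?thesis using dn xy vx by auto
  next
    case 3
    \<comment> \<open>An arc that reaches \<open>w\<close> from the west has height
      \<open>h w\<close> there, which is strictly inside the wedge.\<close>
    have "(u, w) \<notin> R" for u
      using sq[of u w] R_pos[of u w] up dn 3 L_ends(2)[of u w] by auto
    then show ?thesis using up dn 3 vx w'(1) by blast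
  qed
qed

text \<open>Each wedge is charged to the vertex \<open>w\<close> that closes it from the east: to the slot above \<open>w\<close> if its
  lower arc ends at \<open>w\<close>, to the slot below \<open>w\<close> if its upper arc does, and otherwise to \<open>w\<close> as a
  vertex without western arcs.\<close>

definition top_slots :: "'v set" where
  "top_slots = {w \<in> V. \<exists>v x. (v, w) \<in> R \<and> (v, x) \<in> R \<and> Up w (v, x)}"

definition bot_slots :: "'v set" where
  "bot_slots = {w \<in> V. \<exists>v y. (v, w) \<in> R \<and> (v, y) \<in> R \<and> Dn w (v, y)}"

text \<open>Of the arcs that leave a vertex eastwards, one has the greatest slope; each other one is
  the lower side of a wedge. The charge of a wedge can be traced back to it because
  \<open>Up\<close> and \<open>Dn\<close> determine the arc.\<close>

lemma count_east:
  "card R \<le> card {v \<in> V. \<exists>x. (v, x) \<in> R} + card top_slots + card bot_slots + card {w \<in> V. \<forall>u. (u, w) \<notin> R}"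
proof -
  define W where "W = {(v, y). (v, y) \<in> R \<and> (\<exists>x. (v, x) \<in> R \<and> sl v y < sl v x)}"
  define W1 where "W1 = {(v, y). (v, y) \<in> R \<and> (\<exists>x. (v, x) \<in> R \<and> Up y (v, x))}"
  define W2 where "W2 = {(v, y). (v, y) \<in> R \<and> (\<exists>x. (v, x) \<in> R \<and> Dn x (v, y))}"
  define W3 where "W3 = {(v, y). (v, y) \<in> R \<and> (\<exists>w\<in>V. Dn w (v, y) \<and> (\<forall>u. (u, w) \<notin> R))}"
  have sub: "W \<subseteq> R" "W1 \<subseteq> R" "W2 \<subseteq> R" "W3 \<subseteq> R" by (auto simp: W_def W1_def W2_def W3_def)
  then have fin: "finite W" "finite W1" "finite W2" "finite W3" using finR finite_subset by blast+
  have "W \<subseteq> W1 \<union> (W2 \<union> W3)"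
  proof
    fix e assume "e \<in> W"
    then obtain v y where "e = (v, y)" and vy: "(v, y) \<in> R" and "\<exists>x. (v, x) \<in> R \<and> sl v y < sl v x"
      by (auto simp: W_def)
    then show "e \<in> W1 \<union> (W2 \<union> W3)"
      using wedge[OF vy] unfolding W1_def W2_def W3_def by auto
  qed
  then have "card W \<le> card (W1 \<union> (W2 \<union> W3))" using fin by (intro card_mono) auto
  also have "\<dots> \<le> card W1 + (card W2 + card W3)"
    using card_Un_le[of W1 "W2 \<union> W3"] card_Un_le[of W2 W3] by linarith
  finally have W: "card W \<le> card W1 + card W2 + card W3" by simp
  have 1: "card W1 \<le> card top_slots"
  proof (rule card_le_if_inj_on_rel[where r = "\<lambda>e w. w = snd e"])
    show "\<exists>b. b \<in> top_slots \<and> b = snd e" if eW: "e \<in> W1" for e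
    proof -
      obtain v y where e: "e = (v, y)" by (cases e)
      obtain x where "(v, y) \<in> R" "(v, x) \<in> R" "Up y (v, x)"
        using eW unfolding W1_def e by blast
      then have "y \<in> top_slots" unfolding top_slots_def using inV by blast
      then show ?thesis using e by simp
    qed
    show "e = e'" if "e \<in> W1" "e' \<in> W1" "b = snd e" "b = snd e'" for e e' b
      using that Up_unique[of b] unfolding W1_def by fastforce
  qed (use finV in \<open>auto simp: top_slots_def\<close>)
  have 2: "card W2 \<le> card bot_slots"
  proof (rule card_le_if_inj_on_rel[where r = "\<lambda>e w. Dn w e"])
    show "\<exists>b. b \<in> bot_slots \<and> Dn b e" if "e \<in> W2" for e
      using that inV unfolding W2_def bot_slots_def by blast
  qed (use finV Dn_unique in \<open>auto simp: bot_slots_def\<close>)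
  have 3: "card W3 \<le> card {w \<in> V. \<forall>u. (u, w) \<notin> R}"
  proof (rule card_le_if_inj_on_rel[where r = "\<lambda>e w. Dn w e"])
    show "\<exists>b. b \<in> {w \<in> V. \<forall>u. (u, w) \<notin> R} \<and> Dn b e" if "e \<in> W3" for e
      using that unfolding W3_def by blast
  qed (use finV Dn_unique in auto)
  have 4: "card (R - W) \<le> card {v \<in> V. \<exists>x. (v, x) \<in> R}"
  proof (rule card_le_if_inj_on_rel[where r = "\<lambda>e v. v = fst e"])
    fix e e' v assume a: "e \<in> R - W" "e' \<in> R - W" "v = fst e" "v = fst e'"
    obtain x y where "e = (v, x)" "e' = (v, y)" using a by (metis prod.collapse)
    then show "e = e'" using a sl_inj[of v x y] by (auto simp: W_def) (metis linorder_neqE_linordered_idom)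
  qed (use finV inV in auto)
  have "card R = card W + card (R - W)" using sub fin finR by (simp add: card_Diff_subset card_mono)
  then show ?thesis using W 1 2 3 4 by linarith
qed

section \<open>Topmost vertices\<close>

definition topmost :: "'v set" where
  "topmost = {w \<in> V. \<forall>c d. (c, d) \<in> R \<longrightarrow> 0 < cr (z c) (z w) \<longrightarrow> 0 < cr (z w) (z d) \<longrightarrow> L c d (z w) \<le> h w}"

text \<open>Among the vertices on or above the topmost arc just east of \<open>w\<close>, the one nearest to \<open>w\<close> is
  topmost.\<close>

lemma topmost_east:
  assumes wV: "w \<in> V"
  shows "\<exists>t\<in>topmost. 0 < cr (z w) (z t)"
proof -
  have "\<exists>d\<in>{d \<in> V. 0 < cr (z w) (z d)}. \<forall>u\<in>{d \<in> V. 0 < cr (z w) (z d)}. 0 \<le> cr (z d) (z u)"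
    by (intro cr_east_most[where t = "z w"]) (use finV east[OF wV] in auto)
  then obtain b where b: "b \<in> V" "0 < cr (z w) (z b)"
    and near: "\<And>u. u \<in> V \<Longrightarrow> 0 < cr (z w) (z u) \<Longrightarrow> 0 \<le> cr (z b) (z u)" by blast
  have gap: "0 \<le> cr (z u) (z w)" if "u \<in> V" "0 < cr (z u) (z b)" for u
    using near[OF that(1)] that(2) cr_anti[of "z u" "z b"] cr_anti[of "z u" "z w"] by linarith
  \<comment> \<open>Any direction strictly between \<open>w\<close> and the next vertex
    \<open>b\<close> would do; it represents the meridian just east of \<open>w\<close>.\<close>
  define t0 where "t0 = z w + z b"
  have t0: "cr (z u) t0 = cr (z u) (z w) + cr (z u) (z b)" "cr t0 (z u) = cr (z w) (z u) + cr (z b) (z u)" for u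
    by (auto simp: t0_def cr_add1 cr_add2)
  have wt0: "0 < cr (z w) t0" unfolding t0 using b by simp
  define Act where "Act = {(c, d). (c, d) \<in> R \<and> 0 < cr (z c) t0 \<and> 0 < cr t0 (z d)}"
  have "Act \<subseteq> R" by (auto simp: Act_def)
  then have "finite Act" using finR finite_subset by blast
  show ?thesis
  proof (cases "Act = {}")
    case True
    have "b \<in> topmost"
    proof (rule ccontr)
      assume "b \<notin> topmost"
      then obtain c d where cd: "(c, d) \<in> R" "0 < cr (z c) (z b)" "0 < cr (z b) (z d)"
        using b by (auto simp: topmost_def)
      have cw: "0 \<le> cr (z c) (z w)" using gap inV cd by blast
      have "0 < cr (z w) (z d)"
        by (rule cr_inner_pos[of "z c" "z b"]) (use b cw cd R_pos[OF cd(1)] in \<open>auto intro!: add_nonneg_pos\<close>)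
      then have "(c, d) \<in> Act" using cd cw by (simp add: Act_def t0)
      then show False using True by blast
    qed
    then show ?thesis using b by blast
  next
    case False
    have "finite ((\<lambda>(c, d). L c d t0) ` Act)" using \<open>finite Act\<close> by simp
    then have "Max ((\<lambda>(c, d). L c d t0) ` Act) \<in> (\<lambda>(c, d). L c d t0) ` Act" using False by (intro Max_in) auto
    then obtain c d where cdA: "(c, d) \<in> Act" and mx: "Max ((\<lambda>(c, d). L c d t0) ` Act) = L c d t0" by auto
    have top: "L c' d' t0 \<le> L c d t0" if "(c', d') \<in> Act" for c' d'
      unfolding mx[symmetric] using that \<open>finite Act\<close> by (intro Max_ge) force+
    have cd: "(c, d) \<in> R" "0 < cr (z c) t0" "0 < cr t0 (z d)" using cdA by (auto simp: Act_def)
    have pcd: "0 < cr (z c) (z d)" using R_pos cd by blast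
    have cw: "0 \<le> cr (z c) (z w)"
      using gap[OF inV(1)[OF cd(1)]] cd(2) by (cases "0 < cr (z c) (z b)") (auto simp: t0)
    have wd: "0 < cr (z w) (z d)"
      by (rule cr_inner_pos[of "z c" t0]) (use cd cw pcd wt0 in \<open>auto intro!: add_nonneg_pos\<close>)
    define Q where "Q = {u \<in> V. 0 < cr t0 (z u) \<and> 0 \<le> cr (z u) (z d) \<and> L c d (z u) \<le> h u}"
    have "d \<in> Q" using cd inV L_ends[OF cd(1)] by (auto simp: Q_def)
    then have "Q \<noteq> {}" by blast
    moreover have "finite Q" using finV by (auto simp: Q_def)
    ultimately have "\<exists>q\<in>Q. \<forall>u\<in>Q. 0 \<le> cr (z q) (z u)"
      by (intro cr_east_most[where t = t0]) (auto simp: Q_def)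
    then obtain q where q: "q \<in> Q" and qmin: "\<And>u. u \<in> Q \<Longrightarrow> 0 \<le> cr (z q) (z u)" by blast
    have q': "q \<in> V" "0 < cr t0 (z q)" "0 \<le> cr (z q) (z d)" "L c d (z q) \<le> h q" using q by (auto simp: Q_def)
    have wq: "0 < cr (z w) (z q)"
      by (rule cr_outer_pos[of t0 "z d"]) (use q' wd wt0 cd in \<open>auto intro!: add_nonneg_pos\<close>)
    have cq: "0 < cr (z c) (z q)"
      by (rule cr_outer_pos[of t0 "z d"]) (use q' cd pcd in \<open>auto intro!: add_nonneg_pos\<close>)
    have "q \<in> topmost"
    proof (rule ccontr)
      assume "q \<notin> topmost"
      then obtain c2 d2 where e: "(c2, d2) \<in> R" "0 < cr (z c2) (z q)" "0 < cr (z q) (z d2)" "h q < L c2 d2 (z q)"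
        using q' by (force simp: topmost_def)
      have pe: "0 < cr (z c2) (z d2)" using R_pos e by blast
      have lt: "L c d (z q) < L c2 d2 (z q)" using q' e by simp
      then have ne: "(c2, d2) \<noteq> (c, d)" by auto
      have c2V: "c2 \<in> V" using inV e by blast
      \<comment> \<open>A start \<open>c2\<close> in line with \<open>t0\<close> is impossible: in
        the direction of \<open>t0\<close> it would precede \<open>b\<close>, and in the opposite
        direction its arc could not reach over \<open>q\<close>.\<close>
      have c2t0: "cr (z c2) t0 \<noteq> 0"
      proof
        assume "cr (z c2) t0 = 0"
        then have s: "cr (z w) (z c2) + cr (z b) (z c2) = 0"
          using t0 cr_anti[of "z c2" "z w"] cr_anti[of "z c2" "z b"] by simp
        have bq: "0 \<le> cr (z b) (z q)" using near q' wq by blast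
        have "cr (z w) (z c2) \<le> 0" using near[OF c2V] s by linarith
        then have "0 \<le> - cr (z w) (z c2) * cr (z b) (z q)" "0 \<le> cr (z w) (z q) * cr (z b) (z c2)"
          "0 < cr (z w) (z b) * cr (z c2) (z q)"
          using bq s wq b e by (auto intro!: mult_nonneg_nonneg simp: mult_nonpos_nonneg)
        then show False using cr_ptolemy[of "z w" "z c2" "z b" "z q"] by linarith
      qed
      consider "0 < cr t0 (z c2)" | "0 < cr (z c2) t0" using c2t0 cr_anti[of "z c2" t0] by linarith
      then show False
      proof cases
        \<comment> \<open>The covering arc starts between \<open>t0\<close> and \<open>q\<close>, on
          or above \<open>cd\<close>, so its start belongs to \<open>Q\<close> and precedes
          \<open>q\<close>.\<close>
        case 1
        have c2d: "0 < cr (z c2) (z d)"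
          by (rule cr_inner_pos[of t0 "z q"]) (use 1 q' cd e in \<open>auto intro!: add_nonneg_pos\<close>)
        have cc2: "0 < cr (z c) (z c2)"
          by (rule cr_outer_pos[of t0 "z d"]) (use 1 c2d cd pcd in \<open>auto intro!: add_pos_pos\<close>)
        have "L c d (z c2) \<le> L c2 d2 (z c2)"
          by (rule order_kept(2)[OF e(1) cd(1) ne, of "z q"]) (use e pe cq q' c2d cc2 lt in auto)
        then have "c2 \<in> Q" using 1 c2V c2d L_ends[OF e(1)] by (auto simp: Q_def)
        then show False using qmin e(2) cr_anti[of "z q" "z c2"] by force
      next
        \<comment> \<open>The covering arc already passes over \<open>t0\<close>, where
          \<open>cd\<close> is highest, so the two arcs would have equal heights there.\<close>
        case 2
        have t0d2: "0 < cr t0 (z d2)"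
          by (rule cr_inner_pos[of "z c2" "z q"]) (use 2 e pe q' in \<open>auto intro!: add_pos_pos\<close>)
        have "L c2 d2 t0 \<le> L c d t0" using 2 t0d2 e top by (auto simp: Act_def)
        moreover have "L c d t0 \<le> L c2 d2 t0"
          by (rule order_kept(2)[OF e(1) cd(1) ne, of "z q"]) (use e cq q' 2 t0d2 cd lt in auto)
        ultimately show False
          using touch[OF e(1) cd(1) ne 2 t0d2] cd by simp
      qed
    qed
    then show ?thesis using wq by blast
  qed
qed

text \<open>A walk east in steps of less than half a turn is not back at its start after two steps.
  This is the origin of the 3 in \<open>card_top_slots\<close> and \<open>card_arcs\<close>.\<close>

lemma card_topmost:
  assumes "V \<noteq> {}"
  shows "3 \<le> card topmost"
proof -
  have sub: "topmost \<subseteq> V" by (auto simp: topmost_def)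
  obtain v where "v \<in> V" using assms by blast
  then obtain t1 where t1: "t1 \<in> topmost" using topmost_east by blast
  then obtain t2 where t2: "t2 \<in> topmost" "0 < cr (z t1) (z t2)" using topmost_east sub by blast
  then obtain t3 where t3: "t3 \<in> topmost" "0 < cr (z t2) (z t3)" using topmost_east sub by blast
  have "t1 \<noteq> t2" "t2 \<noteq> t3" "t1 \<noteq> t3" using t2 t3 cr_anti[of "z t1" "z t2"] by auto
  then have "card {t1, t2, t3} = 3" by simp
  moreover have "card {t1, t2, t3} \<le> card topmost"
    using t1 t2 t3 sub finV by (intro card_mono) (auto intro: finite_subset)
  ultimately show ?thesis by simp
qed


section \<open>Reflections and the final count of arcs\<close>

text \<open>Changing the sign of the heights exchanges \<open>Up\<close> and \<open>Dn\<close>;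
  conjugating the directions, in \<open>arcs_mirror\<close>, exchanges east and west. Thus
  \<open>count_east\<close> and \<open>card_top_slots\<close> cover all variants.\<close>

lemma arcs_flip: "arcs V z (\<lambda>v. - h v) R"
proof unfold_locales
  fix p q r s t
  assume a: "(p, q) \<in> R" "(r, s) \<in> R" "(p, q) \<noteq> (r, s)" "t \<noteq> 0"
    "0 \<le> cr (z p) t" "0 \<le> cr t (z q)" "0 \<le> cr (z r) t" "0 \<le> cr t (z s)"
    and "(cr t (z q) * - h p + cr (z p) t * - h q) / cr (z p) (z q) =
         (cr t (z s) * - h r + cr (z r) t * - h s) / cr (z r) (z s)"
  then have "- L p q t = - L r s t" unfolding L_def by (simp add: minus_divide_left)
  then show "\<exists>v\<in>{p, q} \<inter> {r, s}. cr (z v) t = 0"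
    using noncross[OF a] unfolding L_def by simp
qed (use finV R_sub R_pos incident parallel east west no_triangle in auto)

lemma arcs_mirror: "arcs V (\<lambda>v. cnj (z v)) h (R\<inverse>)"
proof unfold_locales
  fix p q assume "p \<in> V" "q \<in> V" "p \<noteq> q" "cr (cnj (z p)) (cnj (z q)) = 0"
  then obtain k where "k > 0" "z q = - (of_real k * z p)"
    using parallel[of p q] cr_anti[of "z p" "z q"] by auto
  then show "\<exists>k>0. cnj (z q) = - (of_real k * cnj (z p))" by auto
next
  fix v assume "v \<in> V"
  then show "\<exists>u. (u, v) \<in> R\<inverse> \<or> (v, u) \<in> R\<inverse>" using incident[of v] by blast
next
  fix p q r s t
  assume a: "(p, q) \<in> R\<inverse>" "(r, s) \<in> R\<inverse>" "(p, q) \<noteq> (r, s)" "t \<noteq> 0"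
    "0 \<le> cr (cnj (z p)) t" "0 \<le> cr t (cnj (z q))" "0 \<le> cr (cnj (z r)) t" "0 \<le> cr t (cnj (z s))"
    and e: "(cr t (cnj (z q)) * h p + cr (cnj (z p)) t * h q) / cr (cnj (z p)) (cnj (z q)) =
         (cr t (cnj (z s)) * h r + cr (cnj (z r)) t * h s) / cr (cnj (z r)) (cnj (z s))"
  have c: "cr t (cnj a) = cr a (cnj t)" "cr (cnj a) t = cr (cnj t) a" for a
    using cr_cnj[of "cnj t" a] cr_cnj[of a "cnj t"] by simp_all
  have "\<exists>v\<in>{q, p} \<inter> {s, r}. cr (z v) (cnj t) = 0"
    by (rule noncross) (use a e in \<open>auto simp: c add.commute\<close>)
  then show "\<exists>v\<in>{p, q} \<inter> {r, s}. cr (cnj (z v)) t = 0"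
    unfolding c using cr_anti[of "cnj t"] by auto
qed (use finV R_sub R_pos incident east west no_triangle in auto)

end

context arcs
begin

interpretation mir: arcs V "\<lambda>v. cnj (z v)" h "R\<inverse>" by (rule arcs_mirror)

lemma mir_L: "mir.L q p t = L p q (cnj t)"
proof -
  have c: "cr t (cnj a) = cr a (cnj t)" "cr (cnj a) t = cr (cnj t) a" for a
    using cr_cnj[of "cnj t" a] cr_cnj[of a "cnj t"] by simp_all
  show ?thesis unfolding mir.L_def L_def by (simp add: c add.commute)
qed

lemma mir_Up: "mir.Up w (d, c) \<longleftrightarrow> Up w (c, d)"
  unfolding mir.Up_def Up_def mir_L by auto

lemma Up_not_topmost: "Up w e \<Longrightarrow> w \<notin> topmost"
  unfolding Up_def topmost_def by force

text \<open>A slot used from both sides would close a triangle.\<close>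

lemma card_top_slots:
  assumes "V \<noteq> {}"
  shows "card top_slots + card mir.top_slots + 3 \<le> card V"
proof -
  have "top_slots \<inter> mir.top_slots = {}"
  proof (rule equals0I)
    fix w assume "w \<in> top_slots \<inter> mir.top_slots"
    then obtain v x v' x' where "(v, w) \<in> R" "Up w (v, x)" "(w, v') \<in> R" "(v, x) \<in> R" "Up w (x', v')"
      unfolding top_slots_def mir.top_slots_def mir_Up by blast
    then show False using Up_unique[of w "(v, x)" "(x', v')"] no_triangle by auto
  qed
  moreover have sub: "top_slots \<subseteq> V - topmost" "mir.top_slots \<subseteq> V - topmost"
    using Up_not_topmost unfolding top_slots_def mir.top_slots_def mir_Up by blast+
  moreover have "finite top_slots" "finite mir.top_slots"
    using sub finV by (meson finite_Diff finite_subset)+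
  ultimately have "card top_slots + card mir.top_slots = card (top_slots \<union> mir.top_slots)"
    by (simp add: card_Un_disjoint)
  also have "\<dots> \<le> card (V - topmost)" using sub finV by (intro card_mono) auto
  also have "\<dots> = card V - card topmost" using finV by (intro card_Diff_subset) (auto simp: topmost_def intro: finite_subset)
  finally show ?thesis using card_topmost[OF assms] card_mono[OF finV, of topmost] by (auto simp: topmost_def)
qed

lemma count_west:
  "card R \<le> card {v \<in> V. \<exists>x. (x, v) \<in> R} + card mir.top_slots + card mir.bot_slots + card {w \<in> V. \<forall>u. (w, u) \<notin> R}"
  using mir.count_east by (simp add: card_inverse)

text \<open>In the sum of \<open>count_east\<close> and \<open>count_west\<close>, the vertices with
  an arc on a given side and those without one are both counted, so each side contributes exactly
  \<open>card V\<close>.\<close>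

lemma count_both:
  "2 * card R \<le> 2 * card V + (card top_slots + card mir.top_slots) + (card bot_slots + card mir.bot_slots)"
proof -
  have "card V = card {v \<in> V. \<exists>x. (v, x) \<in> R} + card {v \<in> V. \<forall>x. (v, x) \<notin> R}"
    using finV by (subst card_Un_disjoint[symmetric]) (auto intro!: arg_cong[where f = card])
  moreover have "card V = card {v \<in> V. \<exists>x. (x, v) \<in> R} + card {v \<in> V. \<forall>x. (x, v) \<notin> R}"
    using finV by (subst card_Un_disjoint[symmetric]) (auto intro!: arg_cong[where f = card])
  ultimately show ?thesis using count_east count_west by linarith
qed

interpretation flip: arcs V z "\<lambda>v. - h v" R by (rule arcs_flip)
interpretation flipmir: arcs V "\<lambda>v. cnj (z v)" "\<lambda>v. - h v" "R\<inverse>" by (rule flip.arcs_mirror)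

lemma flip_L: "flip.L p q t = - L p q t" "flipmir.L p q t = - mir.L p q t"
  unfolding flip.L_def L_def flipmir.L_def mir.L_def by (simp_all add: minus_divide_left)

lemma flip_Up: "flip.Up = Dn" "flipmir.Up = mir.Dn"
  by (intro ext, simp add: flip.Up_def Dn_def flipmir.Up_def mir.Dn_def flip_L)+

lemma flip_slots: "flip.top_slots = bot_slots" "flipmir.top_slots = mir.bot_slots"
  unfolding flip.top_slots_def bot_slots_def flipmir.top_slots_def mir.bot_slots_def flip_Up by simp_all

text \<open>Each of the two slot sums is at most \<open>card V - 3\<close>, so twice the number of
  arcs is at most \<open>4 * card V - 6\<close>. A cyclic triangle around the axis, which
  \<open>no_triangle\<close> permits, attains the bound.\<close>

theorem card_arcs:
  assumes "V \<noteq> {}"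
  shows "card R + 3 \<le> 2 * card V"
  using count_both card_top_slots[OF assms] flip.card_top_slots[OF assms] unfolding flip_slots
  by linarith

end

section \<open>Caps whose lenses miss the other circles\<close>

text \<open>The spherical triangle inequality in terms of cosines: \<open>u'\<close> and
  \<open>v'\<close> are the components orthogonal to \<open>x\<close>, of lengths
  \<open>sin p\<close> and \<open>sin q\<close>, and Cauchy-Schwarz bounds their inner
  product.\<close>

lemma inner_unit_bounds:
  fixes u v x :: "'a::real_inner"
  assumes "norm u = 1" "norm v = 1" "norm x = 1" "x \<bullet> u = cos p" "x \<bullet> v = cos q"
    and "0 \<le> p" "p \<le> pi" "0 \<le> q" "q \<le> pi"
  shows "cos (p + q) \<le> u \<bullet> v" "u \<bullet> v \<le> cos (p - q)"
proof -
  have n: "u \<bullet> u = 1" "v \<bullet> v = 1" "x \<bullet> x = 1" using assms by (simp_all add: dot_square_norm)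
  have s: "0 \<le> sin p" "0 \<le> sin q" using assms by (auto intro: sin_ge_zero)
  define u' v' where "u' = u - cos p *\<^sub>R x" and "v' = v - cos q *\<^sub>R x"
  have ss: "1 - cos t * cos t = (sin t)\<^sup>2" for t :: real
    by (simp add: sin_squared_eq power2_eq_square[of "cos t"])
  have "u' \<bullet> u' = 1 - cos p * cos p" "v' \<bullet> v' = 1 - cos q * cos q"
    using n assms by (simp_all add: u'_def v'_def inner_diff_left inner_diff_right inner_commute)
  then have "norm u' = sin p" "norm v' = sin q"
    unfolding ss norm_eq_sqrt_inner using s by simp_all
  moreover have "u' \<bullet> v' = u \<bullet> v - cos p * cos q"
    using n assms by (simp add: u'_def v'_def inner_diff_left inner_diff_right inner_commute)
  ultimately have "\<bar>u \<bullet> v - cos p * cos q\<bar> \<le> sin p * sin q"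
    using Cauchy_Schwarz_ineq2[of u' v'] by simp
  then show "cos (p + q) \<le> u \<bullet> v" "u \<bullet> v \<le> cos (p - q)"
    by (auto simp: cos_add cos_diff)
qed

lemma unit_inner_le:
  assumes "norm (u::'a::real_inner) = 1" "norm v = 1"
  shows "u \<bullet> v \<le> 1" "- 1 \<le> u \<bullet> v"
  using Cauchy_Schwarz_ineq2[of u v] assms by auto

lemma unit_inner_eq_1:
  assumes "norm (u::'a::real_inner) = 1" "norm v = 1" "u \<bullet> v = 1"
  shows "u = v"
proof -
  have "u \<bullet> u = 1" "v \<bullet> v = 1" using assms by (simp_all add: dot_square_norm)
  then have "(u - v) \<bullet> (u - v) = 0"
    using assms by (simp add: inner_diff_left inner_diff_right inner_commute)
  then show ?thesis by simp
qed

lemma unit_combination_zero: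
  assumes "norm (u::'a::real_inner) = 1" "norm v = 1" "u \<noteq> - v" "0 \<le> k" "0 \<le> l"
    and "k *\<^sub>R u + l *\<^sub>R v = 0"
  shows "k = 0 \<and> l = 0"
proof -
  have e: "k *\<^sub>R u = l *\<^sub>R (- v)" using assms(6) by (simp add: eq_neg_iff_add_eq_0)
  then have "norm (k *\<^sub>R u) = norm (l *\<^sub>R (- v))" by simp
  then have "k = l" using assms by simp
  then show ?thesis using e assms(3) by (simp only: scaleR_cancel_left) simp
qed

lemma cos_depth:
  assumes "\<bar>t\<bar> \<le> r" "r \<le> pi"
  shows "cos r \<le> cos t"
  using cos_monotone_0_pi_le[of "\<bar>t\<bar>" r] assms by simp

text \<open>The ordered pair \<open>(i, j)\<close> of \<open>E\<close> stands for the arc from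
  \<open>c i\<close> to \<open>- c j\<close>, so each lens contributes two pairs. The angular radii
  may exceed a right angle.\<close>

locale caps =
  fixes I :: "'i set" and c :: "'i \<Rightarrow> 'a::real_inner" and \<rho> :: "'i \<Rightarrow> real" and E :: "('i \<times> 'i) set"
  assumes unit: "\<And>i. i \<in> I \<Longrightarrow> norm (c i) = 1"
    and radius: "\<And>i. i \<in> I \<Longrightarrow> 0 < \<rho> i \<and> \<rho> i < pi"
    and indep: "\<And>i j. i \<in> I \<Longrightarrow> j \<in> I \<Longrightarrow> i \<noteq> j \<Longrightarrow> c i \<noteq> c j \<and> c i \<noteq> - c j"
    and meet: "\<And>i j. i \<in> I \<Longrightarrow> j \<in> I \<Longrightarrow> i \<noteq> j \<Longrightarrow>
      \<exists>x. norm x = 1 \<and> x \<bullet> c i = cos (\<rho> i) \<and> x \<bullet> c j = cos (\<rho> j)"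
    and E_sub: "E \<subseteq> I \<times> I"
    and E_sym: "\<And>i j. (i, j) \<in> E \<Longrightarrow> (j, i) \<in> E"
    and E_irrefl: "\<And>i. (i, i) \<notin> E"
    and empty: "\<And>i j k x. (i, j) \<in> E \<Longrightarrow> k \<in> I \<Longrightarrow> k \<noteq> i \<Longrightarrow> k \<noteq> j \<Longrightarrow> norm x = 1 \<Longrightarrow>
      x \<bullet> c k = cos (\<rho> k) \<Longrightarrow> cos (\<rho> i) \<le> x \<bullet> c i \<Longrightarrow> cos (\<rho> j) \<le> x \<bullet> c j \<Longrightarrow> False"
begin

lemma E_I: "(i, j) \<in> E \<Longrightarrow> i \<in> I" "(i, j) \<in> E \<Longrightarrow> j \<in> I"
  using E_sub by auto

definition ang :: "'a \<Rightarrow> 'i \<Rightarrow> real" where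
  "ang x i = arccos (x \<bullet> c i)"

lemma ang:
  assumes "i \<in> I" "norm x = 1"
  shows "x \<bullet> c i = cos (ang x i)" "0 \<le> ang x i" "ang x i \<le> pi"
  using unit_inner_le[OF assms(2) unit[OF assms(1)]]
  by (auto simp: ang_def cos_arccos arccos_lbound arccos_ubound)

lemma meet_ang:
  assumes "i \<in> I" "j \<in> I" "i \<noteq> j"
  shows "ang (c i) j \<le> \<rho> i + \<rho> j" "\<bar>\<rho> i - \<rho> j\<bar> \<le> ang (c i) j"
proof -
  obtain x where x: "norm x = 1" "x \<bullet> c i = cos (\<rho> i)" "x \<bullet> c j = cos (\<rho> j)" using meet assms by blast
  note r = radius[OF assms(1)] radius[OF assms(2)]
  note b = inner_unit_bounds[OF unit[OF assms(1)] unit[OF assms(2)] x]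
  note a = ang[OF assms(2) unit[OF assms(1)]]
  show "ang (c i) j \<le> \<rho> i + \<rho> j"
  proof (rule ccontr)
    assume n: "\<not> ?thesis"
    then have "cos (ang (c i) j) < cos (\<rho> i + \<rho> j)"
      using a r by (intro cos_monotone_0_pi) auto
    then show False using b(1) a r by auto
  qed
  show "\<bar>\<rho> i - \<rho> j\<bar> \<le> ang (c i) j"
  proof (rule ccontr)
    assume n: "\<not> ?thesis"
    then have "cos \<bar>\<rho> i - \<rho> j\<bar> < cos (ang (c i) j)"
      using a r by (intro cos_monotone_0_pi) auto
    then show False using b(2) a r by auto
  qed
qed

text \<open>The triangle inequality. \<open>\<rho> i - ang m i\<close> is the depth of
  \<open>m\<close> in the cap, negative outside; \<open>t\<close> is signed because \<open>x\<close>
  may lie on either side of \<open>m\<close> on a great circle.\<close>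

lemma in_cap:
  assumes "i \<in> I" "norm x = 1" "norm m = 1" "x \<bullet> m = cos t" "\<bar>t\<bar> \<le> \<rho> i - ang m i"
  shows "cos (\<rho> i) \<le> x \<bullet> c i"
proof -
  note a = ang[OF assms(1,3)] and r = radius[OF assms(1)]
  have "cos (\<bar>t\<bar> + ang m i) \<le> x \<bullet> c i"
    by (rule inner_unit_bounds(1)[of x "c i" m]) (use assms a r unit in \<open>auto simp: inner_commute\<close>)
  moreover have "cos (\<rho> i) \<le> cos (\<bar>t\<bar> + ang m i)"
    by (rule cos_depth) (use assms a r in auto)
  ultimately show ?thesis by linarith
qed

text \<open>\<open>m\<close> lies on the great-circle segment from \<open>c i\<close> to \<open>c j\<close>; the point \<open>x\<close> is where that great circle
  enters the cap around \<open>c j\<close>.\<close>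

lemma segment_point:
  assumes i: "i \<in> I" and j: "j \<in> I" and ne: "i \<noteq> j" and m: "norm m = 1"
    and k: "0 < k" "0 \<le> \<alpha>" "0 \<le> \<beta>" and eq: "k *\<^sub>R m = \<alpha> *\<^sub>R c i + \<beta> *\<^sub>R c j"
  shows "ang m i + ang m j \<le> \<rho> i + \<rho> j"
    and "\<exists>x. norm x = 1 \<and> x \<bullet> c j = cos (\<rho> j) \<and> cos (\<rho> i) \<le> x \<bullet> c i \<and> x \<bullet> m = cos (\<rho> j - ang m j)"
proof -
  note u = unit[OF i] unit[OF j]
  define \<phi> where "\<phi> = ang (c i) j"
  have cs: "c i \<bullet> c j = cos \<phi>" and \<phi>: "0 \<le> \<phi>" "\<phi> \<le> pi" using ang[OF j u(1)] by (auto simp: \<phi>_def)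
  have "\<phi> \<noteq> 0" using unit_inner_eq_1[OF u] cs indep[OF i j ne] by auto
  moreover have "\<phi> \<noteq> pi" using unit_inner_eq_1[of "c i" "- c j"] u cs indep[OF i j ne] by auto
  ultimately have sp: "0 < sin \<phi>" using \<phi> by (intro sin_gt_zero) auto
  \<comment> \<open>Gram-Schmidt gives an orthonormal frame of the great circle; \<open>X t\<close>
    below is its point at angle \<open>t\<close> from \<open>c i\<close> towards
    \<open>c j\<close>.\<close>
  define e where "e = (1 / sin \<phi>) *\<^sub>R (c j - cos \<phi> *\<^sub>R c i)"
  have uu: "c i \<bullet> c i = 1" "c j \<bullet> c j = 1" "m \<bullet> m = 1" using u m by (simp_all add: dot_square_norm)
  have e0: "c i \<bullet> e = 0" by (simp add: e_def inner_diff_right cs uu)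
  have cj: "c j = cos \<phi> *\<^sub>R c i + sin \<phi> *\<^sub>R e" using sp by (simp add: e_def)
  have ee: "e \<bullet> e = 1"
  proof -
    have "(cos \<phi>)\<^sup>2 + (sin \<phi>)\<^sup>2 * (e \<bullet> e) = 1"
      using uu(2) unfolding cj using uu(1) e0
      by (simp add: inner_add_left inner_add_right inner_commute power2_eq_square)
    then have "(sin \<phi>)\<^sup>2 * (e \<bullet> e) = (sin \<phi>)\<^sup>2" using sin_cos_squared_add[of \<phi>] by linarith
    then show ?thesis using sp by simp
  qed
  define X where "X t = cos t *\<^sub>R c i + sin t *\<^sub>R e" for t
  have XX: "X s \<bullet> X t = cos (s - t)" for s t
    using uu e0 ee by (simp add: X_def inner_add_left inner_add_right inner_commute cos_diff)
  have nX: "norm (X t) = 1" for t using XX[of t t] by (simp add: norm_eq_sqrt_inner)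
  have X0: "c i = X 0" and X\<phi>: "c j = X \<phi>" by (auto simp: X_def cj)
  define p q where "p = (\<alpha> + \<beta> * cos \<phi>) / k" and "q = \<beta> * sin \<phi> / k"
  have "k *\<^sub>R m = k *\<^sub>R (p *\<^sub>R c i + q *\<^sub>R e)"
  proof -
    have "k * p = \<alpha> + \<beta> * cos \<phi>" "k * q = \<beta> * sin \<phi>" using k(1) by (simp_all add: p_def q_def)
    then show ?thesis unfolding eq cj by (simp add: scaleR_add_right scaleR_add_left)
  qed
  then have mpq: "m = p *\<^sub>R c i + q *\<^sub>R e" using k(1) by simp
  have "p\<^sup>2 + q\<^sup>2 = 1" using uu(3) unfolding mpq using uu(1) e0 ee
    by (simp add: inner_add_left inner_add_right inner_commute power2_eq_square)
  moreover have q0: "0 \<le> q" using k sp by (simp add: q_def)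
  ultimately obtain \<theta> where \<theta>: "0 \<le> \<theta>" "\<theta> \<le> pi" "p = cos \<theta>" "q = sin \<theta>"
    using sincos_total_pi by blast
  have mX: "m = X \<theta>" unfolding mpq X_def \<theta> ..
  have "sin (\<phi> - \<theta>) = \<alpha> * sin \<phi> / k"
    using k(1) unfolding sin_diff \<theta>(3,4)[symmetric] p_def q_def by (simp add: field_simps)
  then have "0 \<le> sin (\<phi> - \<theta>)" using k sp by simp
  then have le: "\<theta> \<le> \<phi>"
    using sin_gt_zero[of "\<theta> - \<phi>"] \<theta> \<phi> sin_minus[of "\<phi> - \<theta>"] \<open>\<phi> \<noteq> 0\<close> by (cases "\<theta> \<le> \<phi>") auto
  have ai: "ang m i = \<theta>" unfolding ang_def mX X0 XX using \<theta> by (simp add: arccos_cos)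
  have aj: "ang m j = \<phi> - \<theta>" unfolding ang_def mX X\<phi> XX using \<theta> \<phi> le arccos_cos2[of "\<theta> - \<phi>"] by simp
  show "ang m i + ang m j \<le> \<rho> i + \<rho> j" unfolding ai aj using meet_ang(1)[OF i j ne] by (simp add: \<phi>_def)
  show "\<exists>x. norm x = 1 \<and> x \<bullet> c j = cos (\<rho> j) \<and> cos (\<rho> i) \<le> x \<bullet> c i \<and> x \<bullet> m = cos (\<rho> j - ang m j)"
  \<comment> \<open>The angle \<open>\<phi> - \<rho> j\<close> may be negative; by
    \<open>meet_ang\<close> its absolute value is at most \<open>\<rho> i\<close>, which puts the
    point in the cap around \<open>c i\<close>.\<close>
  proof (intro exI[of _ "X (\<phi> - \<rho> j)"] conjI)
    show "norm (X (\<phi> - \<rho> j)) = 1" by (rule nX)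
    show "X (\<phi> - \<rho> j) \<bullet> c j = cos (\<rho> j)" unfolding X\<phi> XX by simp
    show "cos (\<rho> i) \<le> X (\<phi> - \<rho> j) \<bullet> c i" unfolding X0 XX
      by (rule cos_depth) (use meet_ang[OF i j ne] radius[OF i] radius[OF j] in \<open>auto simp: \<phi>_def\<close>)
    have "X (\<phi> - \<rho> j) \<bullet> m = cos (\<phi> - \<rho> j - \<theta>)" unfolding mX XX ..
    also have "\<dots> = cos (\<rho> j - ang m j)" unfolding aj using cos_minus[of "\<phi> - \<rho> j - \<theta>"] by (simp add: algebra_simps)
    finally show "X (\<phi> - \<rho> j) \<bullet> m = cos (\<rho> j - ang m j)" .
  qed
qed

text \<open>If \<open>c b\<close> were on the segment from \<open>c a\<close> to \<open>c d\<close>,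
  the point where this segment enters the cap of \<open>d\<close> would be in the cap of
  \<open>a\<close> and, by \<open>meet_ang\<close>, within \<open>\<rho> b\<close> of
  \<open>c b\<close>. So it would be a point of circle \<open>d\<close> in the lens of
  \<open>a\<close> and \<open>b\<close>.\<close>

lemma not_between:
  assumes "(a, b) \<in> E" "d \<in> I" "d \<noteq> a" "d \<noteq> b" "0 < k" "0 \<le> \<alpha>" "0 \<le> \<delta>"
    and eq: "k *\<^sub>R c b = \<alpha> *\<^sub>R c a + \<delta> *\<^sub>R c d"
  shows False
proof -
  have I: "a \<in> I" "b \<in> I" using E_I assms by auto
  obtain x where x: "norm x = 1" "x \<bullet> c d = cos (\<rho> d)" "cos (\<rho> a) \<le> x \<bullet> c a" "x \<bullet> c b = cos (\<rho> d - ang (c b) d)"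
    using segment_point(2)[OF I(1) assms(2) _ unit[OF I(2)] assms(5-7) eq] assms by blast
  have "\<bar>\<rho> d - ang (c b) d\<bar> \<le> \<rho> b"
    using meet_ang[OF I(2) assms(2)] assms(4) by force
  then have "cos (\<rho> b) \<le> x \<bullet> c b" unfolding x(4) using radius[OF I(2)] by (intro cos_depth) auto
  then show False using empty assms x by blast
qed

lemma no_crossing_disjoint:
  assumes ab: "(a, b) \<in> E" and cd: "(g, d) \<in> E" and ne: "a \<noteq> g" "a \<noteq> d" "b \<noteq> g" "b \<noteq> d"
    and k: "0 \<le> \<alpha>" "0 \<le> \<beta>" "0 \<le> \<gamma>" "0 \<le> \<delta>"
    and eq: "\<alpha> *\<^sub>R c a + \<delta> *\<^sub>R c d = \<gamma> *\<^sub>R c g + \<beta> *\<^sub>R c b" and nz: "\<alpha> *\<^sub>R c a + \<delta> *\<^sub>R c d \<noteq> 0"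
  shows False
proof -
  note I = E_I[OF ab] E_I[OF cd]
  define s where "s = norm (\<alpha> *\<^sub>R c a + \<delta> *\<^sub>R c d)"
  define m where "m = (1 / s) *\<^sub>R (\<alpha> *\<^sub>R c a + \<delta> *\<^sub>R c d)"
  have s: "0 < s" using nz by (simp add: s_def)
  have m: "norm m = 1" using s by (simp add: m_def s_def)
  have e: "s *\<^sub>R m = \<alpha> *\<^sub>R c a + \<delta> *\<^sub>R c d" "s *\<^sub>R m = \<delta> *\<^sub>R c d + \<alpha> *\<^sub>R c a"
    "s *\<^sub>R m = \<gamma> *\<^sub>R c g + \<beta> *\<^sub>R c b" "s *\<^sub>R m = \<beta> *\<^sub>R c b + \<gamma> *\<^sub>R c g"
    using s eq by (auto simp: m_def add.commute)
  have ne': "d \<noteq> a" "g \<noteq> b" using ne by auto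
  note P = segment_point[OF I(1) I(4) ne(2) m s k(1) k(4) e(1)]
    segment_point[OF I(4) I(1) ne'(1) m s k(4) k(1) e(2)]
    segment_point[OF I(3) I(2) ne'(2) m s k(3) k(2) e(3)]
    segment_point[OF I(2) I(3) ne(3) m s k(2) k(3) e(4)]
  define A B C D where "A = \<rho> a - ang m a" and "B = \<rho> b - ang m b"
    and "C = \<rho> g - ang m g" and "D = \<rho> d - ang m d"
  \<comment> \<open>The point where the segment \<open>ad\<close> enters the cap of \<open>d\<close>
    is on circle \<open>d\<close>, in the cap of \<open>a\<close>, and at distance
    \<open>\<bar>D\<bar>\<close> from \<open>m\<close>. If \<open>\<bar>D\<bar> \<le> B\<close>, it
    is also in the cap of \<open>b\<close>, hence in a lens that circle \<open>d\<close> misses. The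
    other three entry points are treated alike.\<close>
  have "B < \<bar>D\<bar>"
    using P(2) empty[OF ab I(4)] ne in_cap[OF I(2) _ m] unfolding B_def D_def by (metis linorder_not_le)
  moreover have "C < \<bar>A\<bar>"
    using P(4) empty[OF cd I(1)] ne in_cap[OF I(3) _ m] unfolding A_def C_def by (metis linorder_not_le)
  moreover have "D < \<bar>B\<bar>"
    using P(6) empty[OF cd I(2)] ne in_cap[OF I(4) _ m] unfolding B_def D_def by (metis linorder_not_le)
  moreover have "A < \<bar>C\<bar>"
    using P(8) empty[OF ab I(3)] ne in_cap[OF I(1) _ m] unfolding A_def C_def by (metis linorder_not_le)
  \<comment> \<open>The first and third inequalities give \<open>B + D < 0\<close> and the other two
    \<open>A + C < 0\<close>, against the nonnegative sums along the two segments.\<close>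
  moreover have "0 \<le> A + D" "0 \<le> B + C" using P(1,5) unfolding A_def B_def C_def D_def by linarith+
  ultimately show False by linarith
qed

text \<open>\<open>eq'\<close> describes a common point of the segments \<open>ad\<close> and
  \<open>gb\<close>. For four distinct indices \<open>no_crossing_disjoint\<close> applies;
  otherwise the equation puts one centre between two others, against \<open>not_between\<close>, or
  makes coefficients vanish by independence.\<close>

lemma no_crossing:
  assumes ab: "(a, b) \<in> E" and cd: "(g, d) \<in> E" and ne: "(a, b) \<noteq> (g, d)"
    and k: "0 \<le> \<alpha>" "0 \<le> \<beta>" "0 \<le> \<gamma>" "0 \<le> \<delta>"
    and eq: "\<alpha> *\<^sub>R c a - \<beta> *\<^sub>R c b = \<gamma> *\<^sub>R c g - \<delta> *\<^sub>R c d"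
  shows "(\<alpha> = 0 \<and> \<beta> = 0 \<and> \<gamma> = 0 \<and> \<delta> = 0) \<or> (a = g \<and> \<beta> = 0 \<and> \<delta> = 0) \<or> (b = d \<and> \<alpha> = 0 \<and> \<gamma> = 0)"
proof -
  note I = E_I[OF ab] E_I[OF cd]
  have eq': "\<alpha> *\<^sub>R c a + \<delta> *\<^sub>R c d = \<gamma> *\<^sub>R c g + \<beta> *\<^sub>R c b"
    using eq by (simp add: algebra_simps)
  have ab': "a \<noteq> b" "g \<noteq> d" using ab cd E_irrefl by auto
  have zero: "k = 0 \<and> l = 0" if "i \<in> I" "j \<in> I" "i \<noteq> j" "0 \<le> k" "0 \<le> l" "k *\<^sub>R c i + l *\<^sub>R c j = 0" for i j k l
    using unit_combination_zero[OF unit unit] that indep by blast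
  have eq0: "k = 0 \<and> l = 0" if "i \<in> I" "j \<in> I" "i \<noteq> j" "0 \<le> k" "0 \<le> l" "k *\<^sub>R c i = l *\<^sub>R c j" for i j k l
    using unit_combination_zero[of "c i" "- c j" k l] unit that indep[of i j] by auto
  have shared: "q = 0 \<and> s = 0"
    if xy: "(x, y) \<in> E" "(x, y') \<in> E" "y \<noteq> y'" and nn: "0 \<le> p" "0 \<le> q" "0 \<le> r" "0 \<le> s"
      and e: "p *\<^sub>R c x + s *\<^sub>R c y' = r *\<^sub>R c x + q *\<^sub>R c y" for x y y' p q r s
  proof -
    note J = E_I[OF xy(1)] E_I[OF xy(2)]
    have n: "x \<noteq> y" "x \<noteq> y'" using xy E_irrefl by auto
    show ?thesis
    proof (cases "r \<le> p")
      case True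
      have e': "q *\<^sub>R c y = (p - r) *\<^sub>R c x + s *\<^sub>R c y'" using e by (simp add: algebra_simps)
      have "q = 0"
        using not_between[OF xy(1) J(4) _ _ _ _ nn(4) e'] n xy(3) True nn by force
      then show ?thesis using zero[OF J(1) J(4) n(2) _ nn(4), of "p - r"] e' True by simp
    next
      case False
      have e': "s *\<^sub>R c y' = (r - p) *\<^sub>R c x + q *\<^sub>R c y" using e by (simp add: algebra_simps)
      have "s = 0"
        using not_between[OF xy(2) J(2) _ _ _ _ nn(2) e'] n xy(3) False nn by force
      then show ?thesis using zero[OF J(1) J(2) n(1) _ nn(2), of "r - p"] e' False by simp
    qed
  qed
  consider "a = g" | "b = d" | "a \<noteq> g" "b \<noteq> d" "a = d" "b = g" | "a \<noteq> g" "b \<noteq> d" "a = d" "b \<noteq> g"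
    | "a \<noteq> g" "b \<noteq> d" "a \<noteq> d" "b = g" | "a \<noteq> g" "b \<noteq> d" "a \<noteq> d" "b \<noteq> g" by blast
  then show ?thesis
  proof cases
    case 1
    then show ?thesis using shared[of a b d \<alpha> \<beta> \<gamma> \<delta>] ab cd ne k eq' by auto
  next
    case 2
    have "\<delta> *\<^sub>R c b + \<alpha> *\<^sub>R c a = \<beta> *\<^sub>R c b + \<gamma> *\<^sub>R c g"
      using eq' 2 by (simp only: add.commute)
    then show ?thesis using 2 shared[of b g a \<delta> \<gamma> \<beta> \<alpha>] E_sym[OF ab] E_sym[OF cd] ne k
      by auto
  next
    case 3
    have "(\<alpha> + \<delta>) *\<^sub>R c a = (\<gamma> + \<beta>) *\<^sub>R c b"
      using eq' unfolding scaleR_add_left \<open>a = d\<close> \<open>b = g\<close> .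
    then have "\<alpha> + \<delta> = 0 \<and> \<gamma> + \<beta> = 0"
      by (intro eq0[OF I(1,2) ab'(1)]) (use k in auto)
    then show ?thesis using k by auto
  next
    case 4
    have e: "(\<alpha> + \<delta>) *\<^sub>R c a = \<gamma> *\<^sub>R c g + \<beta> *\<^sub>R c b" using eq'[folded 4(3)] by (simp only: scaleR_add_left)
    have "(g, a) \<in> E" using cd 4 by simp
    then have "\<not> 0 < \<alpha> + \<delta>" using not_between[OF _ I(2) _ _ _ k(3) k(2) e] ab' 4 by auto
    then have ad: "\<alpha> = 0" "\<delta> = 0" using k by auto
    have "\<gamma> = 0 \<and> \<beta> = 0"
      by (rule zero[OF I(3) I(2)]) (use e ad k 4 in auto)
    then show ?thesis using ad by simp
  next
    case 5
    have e: "(\<gamma> + \<beta>) *\<^sub>R c b = \<alpha> *\<^sub>R c a + \<delta> *\<^sub>R c d" using eq'[folded 5(4)] by (simp only: scaleR_add_left)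
    have "\<not> 0 < \<gamma> + \<beta>" using not_between[OF ab I(4) _ _ _ k(1) k(4) e] ab' 5 by auto
    then have ad: "\<gamma> = 0" "\<beta> = 0" using k by auto
    have "\<alpha> = 0 \<and> \<delta> = 0"
      by (rule zero[OF I(1) I(4)]) (use e ad k 5 in auto)
    then show ?thesis using ad by simp
  next
    case 6
    have "\<alpha> *\<^sub>R c a + \<delta> *\<^sub>R c d = 0" using no_crossing_disjoint[OF ab cd] 6 k eq' by blast
    then have "\<alpha> = 0 \<and> \<delta> = 0" "\<gamma> = 0 \<and> \<beta> = 0"
      using zero[OF I(1) I(4) _ k(1) k(4)] zero[OF I(3) I(2) _ k(3) k(2)] eq' 6 by metis+
    then show ?thesis by simp
  qed
qed

end

section \<open>From caps to arcs around a generic pole\<close>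

text \<open>The expression is the determinant of \<open>c i\<close>, \<open>c j\<close> and the pole
  \<open>(\<nu>, 1)\<close>. With \<open>\<nu> = Complex s (s\<^sup>2)\<close> it is a quadratic
  polynomial in \<open>s\<close> whose coefficients are the components of the cross product of the
  two centres. These are not all zero, so only finitely many \<open>s\<close> are bad.\<close>

lemma generic_pole:
  fixes c :: "'i \<Rightarrow> complex \<times> real"
  assumes "finite I" and unit: "\<And>i. i \<in> I \<Longrightarrow> norm (c i) = 1"
    and indep: "\<And>i j. i \<in> I \<Longrightarrow> j \<in> I \<Longrightarrow> i \<noteq> j \<Longrightarrow> c i \<noteq> c j \<and> c i \<noteq> - c j"
  shows "\<exists>\<nu>. \<forall>i\<in>I. \<forall>j\<in>I. i \<noteq> j \<longrightarrow>
    cr (fst (c i) - of_real (snd (c i)) * \<nu>) (fst (c j) - of_real (snd (c j)) * \<nu>) \<noteq> 0"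
proof -
  define q :: "'i \<Rightarrow> 'i \<Rightarrow> real poly" where
    "q i j = [: cr (fst (c i)) (fst (c j)), snd (c j) * Im (fst (c i)) - snd (c i) * Im (fst (c j)),
       snd (c i) * Re (fst (c j)) - snd (c j) * Re (fst (c i)) :]" for i j
  have poly_q: "poly (q i j) s = cr (fst (c i) - of_real (snd (c i)) * Complex s (s\<^sup>2))
      (fst (c j) - of_real (snd (c j)) * Complex s (s\<^sup>2))" for i j s
    by (simp add: q_def cr_def algebra_simps power2_eq_square)
  have nz: "q i j \<noteq> 0" if ij: "i \<in> I" "j \<in> I" "i \<noteq> j" for i j
  proof
    assume "q i j = 0"
    then have 0: "cr (fst (c i)) (fst (c j)) = 0" "snd (c j) * Im (fst (c i)) - snd (c i) * Im (fst (c j)) = 0"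
       "snd (c i) * Re (fst (c j)) - snd (c j) * Re (fst (c i)) = 0" by (auto simp: q_def)
    have n: "c i \<bullet> c i = 1" "c j \<bullet> c j = 1" using unit ij by (simp_all add: dot_square_norm)
    have "(c i \<bullet> c i) * (c j \<bullet> c j) - (c i \<bullet> c j)\<^sup>2 =
      (cr (fst (c i)) (fst (c j)))\<^sup>2 + (snd (c j) * Im (fst (c i)) - snd (c i) * Im (fst (c j)))\<^sup>2 +
       (snd (c i) * Re (fst (c j)) - snd (c j) * Re (fst (c i)))\<^sup>2"
      by (simp add: inner_prod_def inner_complex_def cr_def power2_eq_square algebra_simps)
    then have "(c i \<bullet> c j)\<^sup>2 = 1" unfolding 0 n by simp
    then have "c i \<bullet> c j = 1 \<or> c i \<bullet> (- c j) = 1" by (simp add: power2_eq_1_iff)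
    then show False using unit_inner_eq_1[of "c i" "c j"] unit_inner_eq_1[of "c i" "- c j"] unit indep ij by auto
  qed
  have "finite (\<Union>i\<in>I. \<Union>j\<in>I - {i}. {s. poly (q i j) s = 0})"
    using nz assms(1) by (intro finite_UN_I) (auto intro: poly_roots_finite)
  then obtain s where "s \<notin> (\<Union>i\<in>I. \<Union>j\<in>I - {i}. {s. poly (q i j) s = 0})"
    using ex_new_if_finite[OF infinite_UNIV_char_0] by blast
  then show ?thesis unfolding poly_q by (intro exI[of _ "Complex s (s\<^sup>2)"]) blast
qed

lemma card_cap_edges:
  fixes c :: "'i \<Rightarrow> complex \<times> real"
  assumes "caps I c \<rho> E" and fin: "finite I" and ne: "I \<noteq> {}"
    and nonisolated: "\<And>i. i \<in> I \<Longrightarrow> \<exists>j. (i, j) \<in> E"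
  shows "card E + 3 \<le> 4 * card I"
proof -
  interpret caps I c \<rho> E by fact
  obtain \<nu> where \<nu>: "\<And>i j. i \<in> I \<Longrightarrow> j \<in> I \<Longrightarrow> i \<noteq> j \<Longrightarrow>
      cr (fst (c i) - of_real (snd (c i)) * \<nu>) (fst (c j) - of_real (snd (c j)) * \<nu>) \<noteq> 0"
    using generic_pole[of I c, OF fin unit indep] by blast
  \<comment> \<open>\<open>True\<close> marks a centre and \<open>False\<close> its antipode.
    \<open>Z\<close> projects along the pole \<open>(\<nu>, 1)\<close>, and the last coordinate
    serves as height.\<close>
  define P where "P v = (if snd v then c (fst v) else - c (fst v))" for v :: "'i \<times> bool"
  define Z where "Z x = fst x - of_real (snd x) * \<nu>" for x :: "complex \<times> real"
  define z where "z v = Z (P v)" for v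
  define h where "h v = snd (P v)" for v
  define V where "V = I \<times> (UNIV :: bool set)"
  define R where "R = {(p, q). (fst p, fst q) \<in> E \<and> snd p \<noteq> snd q \<and> 0 < cr (z p) (z q)}"
  have Z_lin: "Z (a *\<^sub>R x + b *\<^sub>R y) = of_real a * Z x + of_real b * Z y" for a b x y
    by (simp add: Z_def scaleR_conv_of_real algebra_simps)
  have Z_inj: "x = y" if "Z x = Z y" "snd x = snd y" for x y
    using that by (simp add: Z_def prod_eq_iff)
  have Z_minus: "Z (- x) = - Z x" for x by (simp add: Z_def)
  have crz: "cr (z (i, s)) (z (j, t)) = (if s = t then 1 else - 1) * cr (Z (c i)) (Z (c j))" for i j s t
    by (auto simp: z_def P_def Z_minus)
  have generic: "cr (z p) (z q) \<noteq> 0" if "p \<in> V" "q \<in> V" "fst p \<noteq> fst q" for p q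
    using \<nu>[of "fst p" "fst q"] that crz[of "fst p" "snd p" "fst q" "snd q"]
    by (auto simp: V_def Z_def)
  have neigh: "\<exists>j\<in>I. (i, j) \<in> E \<and> j \<noteq> i" if "i \<in> I" for i
    using nonisolated[OF that] E_I E_irrefl by blast
  have "arcs V z h R"
  proof
    show "finite V" using fin by (simp add: V_def)
    show "R \<subseteq> V \<times> V" using E_I by (auto simp: R_def V_def)
    show "0 < cr (z p) (z q)" if "(p, q) \<in> R" for p q using that by (simp add: R_def)
    show "\<exists>u. (u, v) \<in> R \<or> (v, u) \<in> R" if v: "v \<in> V" for v
    proof -
      obtain i s where vi: "v = (i, s)" "i \<in> I" using v by (auto simp: V_def)
      obtain j where j: "j \<in> I" "(i, j) \<in> E" "j \<noteq> i" using neigh[OF vi(2)] by blast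
      have "cr (z v) (z (j, \<not> s)) \<noteq> 0" using generic[OF v] vi j by (auto simp: V_def)
      then have "0 < cr (z v) (z (j, \<not> s)) \<or> 0 < cr (z (j, \<not> s)) (z v)"
        using cr_anti[of "z v" "z (j, \<not> s)"] by linarith
      then show ?thesis using vi j E_sym by (auto simp: R_def)
    qed
    show "\<exists>k>0. z q = - (of_real k * z p)" if "p \<in> V" "q \<in> V" "p \<noteq> q" "cr (z p) (z q) = 0" for p q
    proof -
      have "fst p = fst q" "snd p \<noteq> snd q" using generic that prod_eq_iff by blast+
      then have "z q = - (of_real 1 * z p)" by (auto simp: z_def P_def Z_minus)
      then show ?thesis using zero_less_one by blast
    qed
    show "\<exists>d\<in>V. 0 < cr (z v) (z d)" if v: "v \<in> V" for v
    proof -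
      obtain i s where vi: "v = (i, s)" "i \<in> I" using v by (auto simp: V_def)
      obtain j where j: "j \<in> I" "j \<noteq> i" using neigh[OF vi(2)] by blast
      have "cr (z v) (z (j, s)) \<noteq> 0" using generic[OF v] vi j by (auto simp: V_def)
      then have "0 < cr (z v) (z (j, s)) \<or> 0 < cr (z v) (z (j, \<not> s))" unfolding vi crz by auto
      then show ?thesis using j by (auto simp: V_def)
    qed
    show "\<exists>d\<in>V. 0 < cr (z d) (z v)" if v: "v \<in> V" for v
    proof -
      obtain i s where vi: "v = (i, s)" "i \<in> I" using v by (auto simp: V_def)
      obtain j where j: "j \<in> I" "j \<noteq> i" using neigh[OF vi(2)] by blast
      have "cr (z (j, s)) (z v) \<noteq> 0" using generic[OF _ v] vi j by (auto simp: V_def)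
      then have "0 < cr (z (j, s)) (z v) \<or> 0 < cr (z (j, \<not> s)) (z v)" unfolding vi crz by auto
      then show ?thesis using j by (auto simp: V_def)
    qed
    \<comment> \<open>Every arc changes the sign, so the two ends of a path of length two have equal
      signs.\<close>
    show "(p, r) \<notin> R" if "(p, q) \<in> R" "(q, r) \<in> R" for p q r
      using that by (auto simp: R_def)
  next
    fix p q r s t
    assume pq: "(p, q) \<in> R" and rs: "(r, s) \<in> R" and ne: "(p, q) \<noteq> (r, s)" and t: "t \<noteq> 0"
      and nn: "0 \<le> cr (z p) t" "0 \<le> cr t (z q)" "0 \<le> cr (z r) t" "0 \<le> cr t (z s)"
      and eq: "(cr t (z q) * h p + cr (z p) t * h q) / cr (z p) (z q) =
        (cr t (z s) * h r + cr (z r) t * h s) / cr (z r) (z s)"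
    have pos: "0 < cr (z p) (z q)" "0 < cr (z r) (z s)" using pq rs by (auto simp: R_def)
    \<comment> \<open>Cramer's rule writes \<open>t\<close> as a nonnegative combination of the ends
      of each arc; equal heights lift the two expansions to an equality of vectors in space.\<close>
    have expand: "t = of_real (cr t b / cr a b) * a + of_real (cr a t / cr a b) * b" if "0 < cr a b" for a b
    proof -
      have "of_real (cr a b) * t = of_real (cr t b) * a + of_real (cr a t) * b"
        by (simp add: complex_eq_iff cr_def algebra_simps)
      then show ?thesis using that by (simp add: field_simps)
    qed
    define \<alpha> \<beta> \<gamma> \<delta> where "\<alpha> = cr t (z q) / cr (z p) (z q)" and "\<beta> = cr (z p) t / cr (z p) (z q)"
      and "\<gamma> = cr t (z s) / cr (z r) (z s)" and "\<delta> = cr (z r) t / cr (z r) (z s)"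
    have k: "0 \<le> \<alpha>" "0 \<le> \<beta>" "0 \<le> \<gamma>" "0 \<le> \<delta>"
      using nn pos by (auto simp: \<alpha>_def \<beta>_def \<gamma>_def \<delta>_def)
    have t1: "t = of_real \<alpha> * z p + of_real \<beta> * z q" and t2: "t = of_real \<gamma> * z r + of_real \<delta> * z s"
      unfolding \<alpha>_def \<beta>_def \<gamma>_def \<delta>_def using expand pos by blast+
    have h12: "\<alpha> * h p + \<beta> * h q = \<gamma> * h r + \<delta> * h s"
      using eq unfolding \<alpha>_def \<beta>_def \<gamma>_def \<delta>_def by (simp add: add_divide_distrib)
    have "Z (\<alpha> *\<^sub>R P p + \<beta> *\<^sub>R P q) = Z (\<gamma> *\<^sub>R P r + \<delta> *\<^sub>R P s)"
      unfolding Z_lin using t1 t2 by (simp add: z_def)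
    moreover have "snd (\<alpha> *\<^sub>R P p + \<beta> *\<^sub>R P q) = snd (\<gamma> *\<^sub>R P r + \<delta> *\<^sub>R P s)"
      using h12 by (simp add: h_def)
    ultimately have vec: "\<alpha> *\<^sub>R P p + \<beta> *\<^sub>R P q = \<gamma> *\<^sub>R P r + \<delta> *\<^sub>R P s"
      by (rule Z_inj)
    have epq: "(fst p, fst q) \<in> E" "(fst q, fst p) \<in> E" "(fst r, fst s) \<in> E" "(fst s, fst r) \<in> E"
      and sg: "snd q = (\<not> snd p)" "snd s = (\<not> snd r)"
      using pq rs E_sym by (auto simp: R_def)
    have zero: "\<not> (\<alpha> = 0 \<and> \<beta> = 0)" using t1 t by auto
    have goal: "\<exists>v\<in>{p, q} \<inter> {r, s}. cr (z v) t = 0"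
      if "(p = r \<and> \<beta> = 0) \<or> (q = s \<and> \<alpha> = 0) \<or> (p = s \<and> \<beta> = 0) \<or> (q = r \<and> \<alpha> = 0)"
    proof -
      have "p \<in> {r, s} \<and> \<beta> = 0 \<or> q \<in> {r, s} \<and> \<alpha> = 0" using that by auto
      then show ?thesis
        using t1 bexI[of "\<lambda>v. cr (z v) t = 0" p "{p, q} \<inter> {r, s}"]
          bexI[of "\<lambda>v. cr (z v) t = 0" q "{p, q} \<inter> {r, s}"] by fastforce
    qed
    have opp: "(u, v) \<in> R \<Longrightarrow> (v, u) \<notin> R" for u v using cr_anti[of "z u" "z v"] by (auto simp: R_def)
    \<comment> \<open>\<open>no_crossing\<close> expects the centre before the antipode, so the
      signs of the west ends decide the order in which the ends of each arc are passed to
      it.\<close>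
    consider "snd p" "snd r" | "snd p" "\<not> snd r" | "\<not> snd p" "snd r" | "\<not> snd p" "\<not> snd r" by blast
    then show "\<exists>v\<in>{p, q} \<inter> {r, s}. cr (z v) t = 0"
    proof cases
      case 1
      have "\<alpha> *\<^sub>R c (fst p) - \<beta> *\<^sub>R c (fst q) = \<gamma> *\<^sub>R c (fst r) - \<delta> *\<^sub>R c (fst s)"
        using vec 1 sg by (simp add: P_def)
      moreover have "(fst p, fst q) \<noteq> (fst r, fst s)"
        using ne 1 sg prod_eq_iff[of p r] prod_eq_iff[of q s] by auto
      ultimately show ?thesis
        using no_crossing[OF epq(1,3) _ k] zero goal 1 sg
          prod_eq_iff[of p r] prod_eq_iff[of q s] by metis
    next
      case 2
      have "\<alpha> *\<^sub>R c (fst p) - \<beta> *\<^sub>R c (fst q) = \<delta> *\<^sub>R c (fst s) - \<gamma> *\<^sub>R c (fst r)"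
        using vec 2 sg by (simp add: P_def)
      moreover have "(fst p, fst q) \<noteq> (fst s, fst r)"
        using opp[OF pq] rs 2 sg prod_eq_iff[of p s] prod_eq_iff[of q r] by auto
      ultimately show ?thesis
        using no_crossing[OF epq(1,4) _ k(1,2,4,3)] zero goal 2 sg
          prod_eq_iff[of p s] prod_eq_iff[of q r] by metis
    next
      case 3
      have "\<beta> *\<^sub>R c (fst q) - \<alpha> *\<^sub>R c (fst p) = \<gamma> *\<^sub>R c (fst r) - \<delta> *\<^sub>R c (fst s)"
        using vec 3 sg by (simp add: P_def)
      moreover have "(fst q, fst p) \<noteq> (fst r, fst s)"
        using opp[OF pq] rs 3 sg prod_eq_iff[of p s] prod_eq_iff[of q r] by auto
      ultimately show ?thesis
        using no_crossing[OF epq(2,3) _ k(2,1,3,4)] zero goal 3 sg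
          prod_eq_iff[of p s] prod_eq_iff[of q r] by metis
    next
      case 4
      have "\<beta> *\<^sub>R c (fst q) - \<alpha> *\<^sub>R c (fst p) = \<delta> *\<^sub>R c (fst s) - \<gamma> *\<^sub>R c (fst r)"
        using vec 4 sg by (simp add: P_def)
      moreover have "(fst q, fst p) \<noteq> (fst s, fst r)"
        using ne 4 sg prod_eq_iff[of p r] prod_eq_iff[of q s] by auto
      ultimately show ?thesis
        using no_crossing[OF epq(2,4) _ k(2,1,4,3)] zero goal 4 sg
          prod_eq_iff[of p r] prod_eq_iff[of q s] by metis
    qed
  qed
  moreover have "V \<noteq> {}" using ne by (auto simp: V_def)
  ultimately have bound: "card R + 3 \<le> 2 * card V" by (rule arcs.card_arcs)
  have "card E \<le> card R"
  proof (rule card_inj_on_le)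
    let ?f = "\<lambda>(i, j). if 0 < cr (z (i, True)) (z (j, False)) then ((i, True), (j, False)) else ((j, False), (i, True))"
    show "inj_on ?f E" by (auto simp: inj_on_def split: if_splits)
    show "?f ` E \<subseteq> R"
    proof (rule image_subsetI)
      fix e assume "e \<in> E"
      then obtain i j where e: "e = (i, j)" and ij: "(i, j) \<in> E" by (cases e) auto
      have "i \<noteq> j" using ij E_irrefl by auto
      then have "cr (z (i, True)) (z (j, False)) \<noteq> 0" using generic E_I[OF ij] by (auto simp: V_def)
      then show "?f e \<in> R" unfolding e using ij E_sym cr_anti[of "z (i, True)" "z (j, False)"] by (auto simp: R_def)
    qed
    show "finite R" using \<open>arcs V z h R\<close> by (rule arcs.finR)
  qed
  moreover have "card V = 2 * card I" by (simp add: V_def card_cartesian_product)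
  ultimately show ?thesis using bound by linarith
qed

section \<open>Circles in the plane\<close>

definition cent :: "complex set \<Rightarrow> complex" where
  "cent C = (SOME c. \<exists>r>0. C = sphere c r)"

definition rad :: "complex set \<Rightarrow> real" where
  "rad C = (SOME r. r > 0 \<and> C = sphere (cent C) r)"

text \<open>The power of a point: negative inside, positive outside.\<close>

definition pw :: "complex set \<Rightarrow> complex \<Rightarrow> real" where
  "pw C z = (norm (z - cent C))\<^sup>2 - (rad C)\<^sup>2"

lemma circle_cent_rad:
  assumes "is_circle C"
  shows "rad C > 0" "C = sphere (cent C) (rad C)"
proof -
  have "\<exists>r>0. C = sphere (cent C) r"
    unfolding cent_def by (rule someI_ex) (use assms in \<open>auto simp: is_circle_def\<close>)
  then have "rad C > 0 \<and> C = sphere (cent C) (rad C)" unfolding rad_def by (rule someI_ex)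
  then show "rad C > 0" "C = sphere (cent C) (rad C)" by auto
qed

lemma circle_iff_pw:
  assumes "is_circle C"
  shows "z \<in> C \<longleftrightarrow> pw C z = 0"
proof -
  have "z \<in> C \<longleftrightarrow> norm (z - cent C) = rad C"
    by (subst circle_cent_rad(2)[OF assms]) (simp add: dist_norm norm_minus_commute)
  also have "\<dots> \<longleftrightarrow> pw C z = 0"
    using circle_cent_rad(1)[OF assms] by (simp add: pw_def)
  finally show ?thesis .
qed

lemma continuous_pw [continuous_intros]: "continuous_on S (pw C)"
  unfolding pw_def by (intro continuous_intros)

lemma closed_circle: "is_circle C \<Longrightarrow> closed C"
  using circle_cent_rad(2) closed_sphere by metis

text \<open>As \<open>p\<close> is on the circle, the term quadratic in \<open>w\<close> vanishes.
  Up to a positive factor, inversion at \<open>p\<close> thus turns the sides of the circle into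
  those of a line.\<close>

lemma pw_inversion:
  assumes "is_circle C" "p \<in> C" "w \<noteq> 0"
  shows "pw C (p + 1 / w) = (2 * Re ((p - cent C) * w) + 1) / (norm w)\<^sup>2"
proof -
  define d where "d = p - cent C"
  have d: "(norm d)\<^sup>2 = (rad C)\<^sup>2" using circle_iff_pw[OF assms(1)] assms(2) by (simp add: pw_def d_def)
  have "(norm (d + 1 / w))\<^sup>2 * (norm w)\<^sup>2 = (norm (d * w + 1))\<^sup>2"
  proof -
    have "(d + 1 / w) * w = d * w + 1" using assms(3) by (simp add: distrib_right)
    then show ?thesis by (metis norm_mult power_mult_distrib)
  qed
  also have "\<dots> = (norm d)\<^sup>2 * (norm w)\<^sup>2 + 2 * Re (d * w) + 1"
    unfolding cmod_power2 by (simp add: algebra_simps power2_eq_square)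
  finally have "((norm (d + 1 / w))\<^sup>2 - (rad C)\<^sup>2) * (norm w)\<^sup>2 = 2 * Re (d * w) + 1"
    using d by (simp add: algebra_simps)
  moreover have "pw C (p + 1 / w) = (norm (d + 1 / w))\<^sup>2 - (rad C)\<^sup>2"
    by (simp add: pw_def d_def algebra_simps)
  ultimately show ?thesis using assms(3) by (simp add: d_def eq_divide_eq)
qed

text \<open>Sign 1 selects the inside of a circle and -1 the outside. The two circles may coincide,
  as they do in \<open>disc_digon\<close>.\<close>

definition sector :: "complex set \<Rightarrow> real \<Rightarrow> complex set \<Rightarrow> real \<Rightarrow> complex set" where
  "sector A s B t = {z. s * pw A z < 0 \<and> t * pw B z < 0}"

lemma open_sector: "open (sector A s B t)"
proof -
  have "open {z. s * pw A z < 0}" "open {z. t * pw B z < 0}"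
    by (intro open_Collect_less continuous_intros)+
  then show ?thesis unfolding sector_def by (simp add: Collect_conj_eq open_Int)
qed

text \<open>Inversion at the common point turns the region into an intersection of two open
  half-planes without 0, and removing a point keeps a connected open plane set connected.\<close>

lemma connected_sector:
  assumes "is_circle A" "is_circle B" "p \<in> A" "p \<in> B"
  shows "connected (sector A s B t)"
proof -
  define H where "H C u = {w. u * (2 * Re ((p - cent C) * w) + 1) < 0}" for C u
  have H: "open (H C u) \<and> convex (H C u)" for C u
  proof -
    have e: "H C u = {w. inner (2 * u * cnj (p - cent C)) w < - u}"
      by (auto simp: H_def inner_complex_def algebra_simps)
    show ?thesis unfolding e by (simp add: open_halfspace_lt convex_halfspace_lt)
  qed
  have "connected (H A s \<inter> H B t - {0})"
    using H[of A s] H[of B t] by (intro connected_open_delete convex_connected convex_Int open_Int) auto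
  then have "connected ((\<lambda>w. p + 1 / w) ` (H A s \<inter> H B t - {0}))"
    by (intro connected_continuous_image continuous_intros) auto
  also have "(\<lambda>w. p + 1 / w) ` (H A s \<inter> H B t - {0}) = sector A s B t"
  proof -
    have iff: "p + 1 / w \<in> sector A s B t \<longleftrightarrow> w \<in> H A s \<inter> H B t" if "w \<noteq> 0" for w
      using that unfolding sector_def H_def
      by (simp add: pw_inversion[OF assms(1,3) that] pw_inversion[OF assms(2,4) that] divide_less_0_iff)
    show ?thesis
    proof
      show "(\<lambda>w. p + 1 / w) ` (H A s \<inter> H B t - {0}) \<subseteq> sector A s B t" using iff by auto
      show "sector A s B t \<subseteq> (\<lambda>w. p + 1 / w) ` (H A s \<inter> H B t - {0})"
      proof
        fix z assume z: "z \<in> sector A s B t"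
        have "pw A p = 0" using circle_iff_pw assms by blast
        then have "z \<noteq> p" using z by (auto simp: sector_def)
        then have w: "1 / (z - p) \<noteq> 0" "p + 1 / (1 / (z - p)) = z" by auto
        then show "z \<in> (\<lambda>w. p + 1 / w) ` (H A s \<inter> H B t - {0})"
          using iff[OF w(1)] z by (intro image_eqI[of _ _ "1 / (z - p)"]) auto
      qed
    qed
  qed
  finally show ?thesis .
qed

lemma frontier_sector:
  assumes "is_circle A" "is_circle B"
  shows "frontier (sector A s B t) \<subseteq> A \<union> B"
    and "closure (sector A s B t) \<subseteq> {z. s * pw A z \<le> 0 \<and> t * pw B z \<le> 0}"
proof -
  have "closed {z. s * pw A z \<le> 0}" "closed {z. t * pw B z \<le> 0}"
    by (intro closed_Collect_le continuous_intros)+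
  then have "closed {z. s * pw A z \<le> 0 \<and> t * pw B z \<le> 0}" by (simp add: Collect_conj_eq closed_Int)
  then show cl: "closure (sector A s B t) \<subseteq> {z. s * pw A z \<le> 0 \<and> t * pw B z \<le> 0}"
    by (intro closure_minimal) (auto simp: sector_def)
  show "frontier (sector A s B t) \<subseteq> A \<union> B"
  proof
    fix z assume z: "z \<in> frontier (sector A s B t)"
    then have "z \<in> closure (sector A s B t)" "z \<notin> sector A s B t"
      using open_sector by (auto simp: frontier_def interior_open)
    then have "s * pw A z = 0 \<or> t * pw B z = 0" "z \<notin> sector A s B t" using cl by (force simp: sector_def)+
    show "z \<in> A \<union> B"
    proof (rule ccontr)
      assume "z \<notin> A \<union> B"
      then have "s = 0 \<or> t = 0" using \<open>s * pw A z = 0 \<or> t * pw B z = 0\<close> circle_iff_pw assms by auto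
      then have "sector A s B t = {}" by (auto simp: sector_def)
      then show False using z by simp
    qed
  qed
qed

lemma near_side:
  assumes "is_circle A" "y \<in> A" "open U" "y \<in> U" "s = 1 \<or> s = - 1"
  shows "\<exists>z\<in>U. s * pw A z < 0"
proof -
  have r: "rad A > 0" "norm (y - cent A) = rad A"
    using circle_cent_rad[OF assms(1)] assms(2) by (metis, metis dist_norm mem_sphere norm_minus_commute)
  \<comment> \<open>Moves \<open>y\<close> along its radius, inwards for sign 1 and outwards for
    sign -1.\<close>
  define g where "g k = cent A + of_real (1 - s * k) * (y - cent A)" for k :: real
  have "continuous_on UNIV g" unfolding g_def by (intro continuous_intros)
  then have "open (g -` U)" using assms(3) by (simp add: open_vimage)
  moreover have "0 \<in> g -` U" using assms(4) by (simp add: g_def)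
  ultimately obtain e where e: "e > 0" "ball 0 e \<subseteq> g -` U" by (meson open_contains_ball)
  define k where "k = min (e / 2) (1 / 2)"
  have k: "0 < k" "k < e" "k < 1" using e by (auto simp: k_def)
  then have "g k \<in> U" using e by (auto simp: subset_iff)
  moreover have "s * pw A (g k) < 0"
  proof -
    have "pw A (g k) = ((1 - s * k)\<^sup>2 - 1) * (rad A)\<^sup>2"
    proof -
      have "g k - cent A = of_real (1 - s * k) * (y - cent A)" by (simp add: g_def)
      then have "norm (g k - cent A) = \<bar>1 - s * k\<bar> * rad A" by (simp only: norm_mult norm_of_real r(2))
      then show ?thesis by (simp add: pw_def power_mult_distrib left_diff_distrib)
    qed
    also have "\<dots> = - s * (k * (2 - s * k)) * (rad A)\<^sup>2"
      using assms(5) by (auto simp: power2_eq_square algebra_simps)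
    finally have "s * pw A (g k) = - (k * (2 - s * k)) * (rad A)\<^sup>2" using assms(5) by auto
    moreover have "0 < k * (2 - s * k)" using k assms(5) by (intro mult_pos_pos) auto
    ultimately show ?thesis using r(1) by (simp add: mult_less_0_iff)
  qed
  ultimately show ?thesis by blast
qed

text \<open>Both sets are connected and contain \<open>z\<close>, and neither meets the frontier of
  the other, since both frontiers lie on \<open>A\<close> and \<open>B\<close>.\<close>

lemma face_eq_sector:
  assumes circ: "\<And>C. C \<in> F \<Longrightarrow> is_circle C" and f: "f \<in> faces F"
    and AB: "A \<in> F" "B \<in> F" "p \<in> A" "p \<in> B" and fr: "frontier f \<subseteq> A \<union> B"
  shows "\<exists>s t. (s = 1 \<or> s = - 1) \<and> (t = 1 \<or> t = - 1) \<and> f = sector A s B t"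
proof -
  have f': "f \<noteq> {}" "connected f" "f \<inter> \<Union>F = {}"
    using f in_components_nonempty in_components_connected in_components_subset
    unfolding faces_def by blast+
  then obtain z where z: "z \<in> f" by blast
  have n: "pw C z \<noteq> 0" if "C \<in> F" for C using that f' z circle_iff_pw[OF circ] by blast
  define s t where "s = - sgn (pw A z)" and "t = - sgn (pw B z)"
  have st: "s = 1 \<or> s = - 1" "t = 1 \<or> t = - 1"
    using n AB by (auto simp: s_def t_def sgn_if)
  have zS: "z \<in> sector A s B t"
    using n[OF AB(1)] n[OF AB(2)] by (auto simp: sector_def s_def t_def sgn_if)
  have disj: "sector A s B t \<inter> (A \<union> B) = {}"
    using circle_iff_pw[OF circ] AB by (auto simp: sector_def)
  have "sector A s B t \<subseteq> f"
    using connected_Int_frontier[OF connected_sector[OF circ circ AB(3,4)], of s t f] AB z zS disj fr by blast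
  moreover have "f \<subseteq> sector A s B t"
    using connected_Int_frontier[OF f'(2), of "sector A s B t"] z zS f'(3) AB
      frontier_sector(1)[OF circ circ, OF AB(1,2), of s t] by blast
  ultimately show ?thesis using st by blast
qed

text \<open>Inversion at \<open>p\<close> turns the circle minus \<open>p\<close> into a line, which gives a coordinate on it.\<close>

definition circ_par :: "complex set \<Rightarrow> complex \<Rightarrow> real \<Rightarrow> complex" where
  "circ_par A p \<tau> = p + (p - cent A) / Complex (- 1 / 2) \<tau>"

definition circ_coord :: "complex set \<Rightarrow> complex \<Rightarrow> complex \<Rightarrow> real" where
  "circ_coord A p z = Im ((p - cent A) / (z - p))"

lemma circ_par:
  assumes "is_circle A" "p \<in> A"
  shows "circ_par A p \<tau> \<in> A" "circ_par A p \<tau> \<noteq> p" "circ_coord A p (circ_par A p \<tau>) = \<tau>"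
proof -
  have "pw A p = 0" using assms circle_iff_pw by blast
  then have pa: "p - cent A \<noteq> 0" using circle_cent_rad(1)[OF assms(1)] by (auto simp: pw_def)
  define \<zeta> where "\<zeta> = Complex (- 1 / 2) \<tau>"
  have \<zeta>: "\<zeta> \<noteq> 0" "Re \<zeta> = - 1 / 2" "Im \<zeta> = \<tau>" by (auto simp: \<zeta>_def complex_eq_iff)
  have w: "\<zeta> / (p - cent A) \<noteq> 0" using \<zeta> pa by simp
  have par: "circ_par A p \<tau> = p + (p - cent A) / \<zeta>" by (simp only: circ_par_def \<zeta>_def)
  have "pw A (circ_par A p \<tau>) = 0"
    unfolding par using pw_inversion[OF assms w] pa \<zeta> by simp
  then show "circ_par A p \<tau> \<in> A" using circle_iff_pw assms by blast
  show "circ_par A p \<tau> \<noteq> p" "circ_coord A p (circ_par A p \<tau>) = \<tau>"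
    unfolding par circ_coord_def using pa \<zeta> by auto
qed

lemma circ_par_coord:
  assumes "is_circle A" "p \<in> A" "z \<in> A" "z \<noteq> p"
  shows "circ_par A p (circ_coord A p z) = z"
proof -
  have w: "1 / (z - p) \<noteq> 0" using assms(4) by simp
  have "pw A (p + 1 / (1 / (z - p))) = 0" using circle_iff_pw[OF assms(1)] assms(3) by simp
  then have "2 * Re ((p - cent A) * (1 / (z - p))) + 1 = 0"
    unfolding pw_inversion[OF assms(1,2) w] using w by (simp add: divide_eq_0_iff)
  then have e: "Complex (- 1 / 2) (circ_coord A p z) = (p - cent A) / (z - p)"
    by (simp add: complex_eq_iff circ_coord_def)
  have "pw A p = 0" using assms circle_iff_pw by blast
  then have pa: "p - cent A \<noteq> 0" using circle_cent_rad(1)[OF assms(1)] by (auto simp: pw_def)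
  show ?thesis unfolding circ_par_def e using pa by simp
qed

lemma continuous_circ_par: "continuous_on UNIV (circ_par A p)"
proof -
  have "Complex (- 1 / 2) \<tau> \<noteq> 0" for \<tau> by (simp add: complex_eq_iff)
  moreover have "Complex (- 1 / 2) = (\<lambda>\<tau>. of_real (- 1 / 2) + \<i> * of_real \<tau>)"
    by (auto simp: complex_eq_iff)
  ultimately show ?thesis
    unfolding circ_par_def by (intro continuous_intros) (auto intro!: continuous_intros)
qed

lemma continuous_circ_coord: "continuous_on (- {p}) (circ_coord A p)"
  unfolding circ_coord_def by (intro continuous_intros) auto

lemma connected_circle_minus_point:
  assumes "is_circle A" "p \<in> A"
  shows "connected (A - {p})"
proof -
  have "A - {p} = range (circ_par A p)"
  proof
    show "A - {p} \<subseteq> range (circ_par A p)" using circ_par_coord[OF assms] by (metis DiffE insertCI rangeI subsetI)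
    show "range (circ_par A p) \<subseteq> A - {p}" using circ_par[OF assms] by auto
  qed
  then show ?thesis using connected_continuous_image[OF continuous_circ_par connected_UNIV] by metis
qed

text \<open>The coordinate takes all intermediate values on a connected set that avoids
  \<open>p\<close>, so an arc reaching both sides of \<open>x\<close> would contain
  \<open>x\<close>.\<close>

lemma arc_separation:
  assumes A: "is_circle A" "p \<in> A" "x \<in> A" "x \<noteq> p"
    and e: "connected e" "e \<subseteq> A - {p, x}"
    and y: "y1 \<in> closure e" "y2 \<in> closure e" "y1 \<noteq> p" "y2 \<noteq> p"
    and lt: "circ_coord A p y1 < circ_coord A p x" "circ_coord A p x < circ_coord A p y2"
  shows False
proof -
  let ?\<phi> = "circ_coord A p"
  have op: "open {z \<in> - {p}. ?\<phi> z \<in> T}" if "open T" for T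
  proof -
    have "open (- {p})" by (rule open_Compl) simp
    then have "open (- {p} \<inter> ?\<phi> -` T)" using continuous_open_preimage[OF continuous_circ_coord _ that] by blast
    then show ?thesis by (simp add: Int_def vimage_def)
  qed
  have "{z \<in> - {p}. ?\<phi> z \<in> {..<?\<phi> x}} \<inter> e \<noteq> {}" "{z \<in> - {p}. ?\<phi> z \<in> {?\<phi> x<..}} \<inter> e \<noteq> {}"
    using open_Int_closure_eq_empty[OF op, of "{..<?\<phi> x}" e]
      open_Int_closure_eq_empty[OF op, of "{?\<phi> x<..}" e] y lt by auto
  then obtain u v where uv: "u \<in> e" "?\<phi> u < ?\<phi> x" "v \<in> e" "?\<phi> x < ?\<phi> v" by auto
  have "continuous_on e ?\<phi>"
    using e(2) by (intro continuous_on_subset[OF continuous_circ_coord]) auto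
  then have "connected (?\<phi> ` e)" using e(1) by (rule connected_continuous_image)
  then have "?\<phi> x \<in> ?\<phi> ` e" using uv unfolding connected_iff_interval by (meson image_eqI less_imp_le)
  then obtain z where "z \<in> e" "?\<phi> z = ?\<phi> x" by auto
  then have "z = x" using circ_par_coord[OF A(1,2)] A(3,4) e(2) by (metis DiffD1 DiffD2 insert_iff subsetD)
  then show False using \<open>z \<in> e\<close> e(2) by auto
qed

lemma arc_not_across:
  assumes A: "is_circle A" "p \<in> A" "x \<in> A" "x \<noteq> p"
    and e: "connected e" "e \<subseteq> A - {p, x}"
    and U: "open U" "x \<in> U" "A \<inter> U \<subseteq> closure e"
  shows False
proof -
  have "open (circ_par A p -` U)" using continuous_circ_par U(1) by (simp add: open_vimage)
  moreover have "circ_coord A p x \<in> circ_par A p -` U" using circ_par_coord[OF A] U(2) by simp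
  ultimately obtain d where d: "d > 0" "ball (circ_coord A p x) d \<subseteq> circ_par A p -` U"
    by (meson open_contains_ball)
  have "circ_par A p \<tau> \<in> closure e" if "\<bar>\<tau> - circ_coord A p x\<bar> < d" for \<tau>
    using d(2) U(3) circ_par(1)[OF A(1,2), of \<tau>] that by (auto simp: dist_real_def subset_iff)
  then have "circ_par A p (circ_coord A p x - d / 2) \<in> closure e" "circ_par A p (circ_coord A p x + d / 2) \<in> closure e"
    using d(1) by auto
  then show False
    by (rule arc_separation[OF A e]) (use circ_par[OF A(1,2)] d in auto)
qed

text \<open>With \<open>v1\<close> sent to infinity, the other two points cut a line into three
  intervals. Of one sample point from each, two fall to the same closure, and its arc would have to
  cross a cut point.\<close>

lemma two_arcs_three_points:
  assumes A: "is_circle A" "v1 \<in> A" "v2 \<in> A" "v3 \<in> A" "v1 \<noteq> v2" "v1 \<noteq> v3" "v2 \<noteq> v3"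
    and e: "connected e" "e \<subseteq> A - {v1, v2, v3}" and e': "connected e'" "e' \<subseteq> A - {v1, v2, v3}"
    and cover: "A \<subseteq> closure e \<union> closure e'"
  shows False
proof -
  let ?\<phi> = "circ_coord A v1" and ?h = "circ_par A v1"
  have ord: False if v: "v \<in> A" "w \<in> A" "v \<noteq> v1" "w \<noteq> v1" "{v1, v} \<subseteq> {v1, v2, v3}" "{v1, w} \<subseteq> {v1, v2, v3}"
    and lt: "?\<phi> v < ?\<phi> w" for v w
  proof -
    define y where "y k = ?h (if k = 0 then ?\<phi> v - 1 else if k = 1 then (?\<phi> v + ?\<phi> w) / 2 else ?\<phi> w + 1)" for k :: nat
    have y: "y k \<in> A" "y k \<noteq> v1" for k using circ_par[OF A(1,2)] by (simp_all add: y_def)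
    have \<phi>y: "?\<phi> (y 0) < ?\<phi> v" "?\<phi> v < ?\<phi> (y 1)" "?\<phi> (y 1) < ?\<phi> w" "?\<phi> w < ?\<phi> (y 2)"
      using lt circ_par(3)[OF A(1,2)] by (auto simp: y_def)
    have sep: "\<not> (y i \<in> closure d \<and> y j \<in> closure d)"
      if d: "connected d" "d \<subseteq> A - {v1, v2, v3}" and ij: "(i, j) \<in> {(0, 1), (1, 2), (0, 2)}" for d i j
    proof
      assume c: "y i \<in> closure d \<and> y j \<in> closure d"
      have dd: "d \<subseteq> A - {v1, v}" "d \<subseteq> A - {v1, w}" using d(2) v by auto
      have "(?\<phi> (y i) < ?\<phi> v \<and> ?\<phi> v < ?\<phi> (y j)) \<or> (?\<phi> (y i) < ?\<phi> w \<and> ?\<phi> w < ?\<phi> (y j))"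
        using ij \<phi>y by auto
      then show False
        using arc_separation[OF A(1,2) v(1,3) d(1) dd(1), of "y i" "y j"]
          arc_separation[OF A(1,2) v(2,4) d(1) dd(2), of "y i" "y j"] c y by blast
    qed
    have "y k \<in> closure e \<or> y k \<in> closure e'" for k using y(1) cover by blast
    from this[of 0] this[of 1] this[of 2] show False
      using sep[OF e, of 0 1] sep[OF e, of 1 2] sep[OF e, of 0 2]
        sep[OF e', of 0 1] sep[OF e', of 1 2] sep[OF e', of 0 2] by simp blast
  qed
  have ne: "v2 \<noteq> v1" "v3 \<noteq> v1" using A by auto
  have "?h (?\<phi> v2) \<noteq> ?h (?\<phi> v3)"
    using circ_par_coord[OF A(1,2) A(3) ne(1)] circ_par_coord[OF A(1,2) A(4) ne(2)] A(7) by simp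
  then consider "?\<phi> v2 < ?\<phi> v3" | "?\<phi> v3 < ?\<phi> v2" by (metis linorder_neqE_linordered_idom)
  then show False
  proof cases
    case 1 show False by (rule ord[OF A(3,4) ne _ _ 1]) auto
  next
    case 2 show False by (rule ord[OF A(4,3) ne(2,1) _ _ 2]) auto
  qed
qed

section \<open>Digons are lenses\<close>

lemma sector_commute: "sector A s B t = sector B t A s"
  by (auto simp: sector_def)

locale circle_arrangement =
  fixes F :: "complex set set"
  assumes fin: "finite F"
    and circ: "\<And>C. C \<in> F \<Longrightarrow> is_circle C"
    and meets: "\<And>A B. A \<in> F \<Longrightarrow> B \<in> F \<Longrightarrow> A \<noteq> B \<Longrightarrow> A \<inter> B \<noteq> {}"
    and simple: "simple_arrangement F"
begin

lemma pw_0: "C \<in> F \<Longrightarrow> pw C z = 0 \<longleftrightarrow> z \<in> C"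
  using circle_iff_pw circ by blast

lemma no_triple:
  assumes "A \<in> F" "B \<in> F" "C \<in> F" "A \<noteq> B" "A \<noteq> C" "B \<noteq> C" "x \<in> A" "x \<in> B" "x \<in> C"
  shows False
  using simple assms unfolding simple_arrangement_def by blast

text \<open>The closed lens, not just the open face, has to be free of other circles, as in the
  assumption \<open>empty\<close> of \<open>caps\<close>.\<close>

definition empty_lens :: "complex set \<Rightarrow> real \<Rightarrow> complex set \<Rightarrow> real \<Rightarrow> bool" where
  "empty_lens A s B t \<longleftrightarrow> A \<in> F \<and> B \<in> F \<and> A \<noteq> B \<and> (s = 1 \<or> s = - 1) \<and> (t = 1 \<or> t = - 1) \<and>
     (\<forall>C\<in>F. C \<noteq> A \<longrightarrow> C \<noteq> B \<longrightarrow> (\<forall>x\<in>C. \<not> (s * pw A x \<le> 0 \<and> t * pw B x \<le> 0)))"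

lemma empty_lens_commute: "empty_lens A s B t \<Longrightarrow> empty_lens B t A s"
  unfolding empty_lens_def by blast

definition lens_digons :: "complex set set" where
  "lens_digons = {f \<in> digons F. \<exists>A s B t. empty_lens A s B t \<and> f = sector A s B t}"

text \<open>With three circles, a circle that is tangent to the two others is the boundary of a face and is
  divided into two edges.\<close>

definition disc_digon :: "complex set \<Rightarrow> complex set \<Rightarrow> bool" where
  "disc_digon f A \<longleftrightarrow> f \<in> digons F \<and> A \<in> F \<and> (\<exists>s. (s = 1 \<or> s = - 1) \<and> f = sector A s A s) \<and>
     (\<exists>e e'. e \<noteq> e' \<and> e \<in> components (A - vertices F) \<and> e' \<in> components (A - vertices F) \<and>
        A \<subseteq> closure e \<union> closure e')"

lemma digon_face:
  assumes "f \<in> digons F"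
  shows "f \<in> components (- \<Union>F)" "f \<noteq> {}" "f \<inter> \<Union>F = {}"
  using assms in_components_nonempty in_components_subset unfolding digons_def faces_def by blast+

lemma sector_frontier_points:
  assumes f: "f \<inter> \<Union>F = {}" "f = sector A s B t" and AB: "A \<in> F" "s = 1 \<or> s = - 1"
    and y: "y \<in> A" "t * pw B y < 0"
  shows "y \<in> frontier f"
proof -
  have oU: "open {z. t * pw B z < 0}" by (intro open_Collect_less continuous_intros)
  have "y \<in> closure f"
    unfolding closure_iff_nhds_not_empty
  proof (intro allI impI)
    fix N T assume "T \<subseteq> N" "open T" "y \<in> T"
    then obtain z where "z \<in> T \<inter> {z. t * pw B z < 0}" "s * pw A z < 0"
      using near_side[OF circ[OF AB(1)] y(1), of "T \<inter> {z. t * pw B z < 0}" s] oU y(2) AB(2) by blast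
    then have "z \<in> f \<inter> N" using \<open>T \<subseteq> N\<close> f(2) by (auto simp: sector_def)
    then show "f \<inter> N \<noteq> {}" by blast
  qed
  moreover have "y \<notin> f" using f(1) y(1) AB(1) by blast
  ultimately show ?thesis using f(2) open_sector by (auto simp: frontier_def interior_open)
qed

text \<open>A vertex on the open arc of \<open>A\<close> that bounds the face would split this arc, but the whole arc lies in
  the closure of the single edge \<open>e\<close>.\<close>

lemma arc_free:
  assumes f: "f \<inter> \<Union>F = {}" "f = sector A s B t" "frontier f = closure e \<union> closure e'"
    and AB: "A \<in> F" "B \<in> F" "A \<noteq> B" "s = 1 \<or> s = - 1"
    and e: "connected e" "e \<subseteq> A - vertices F" "e' \<subseteq> B"
    and x: "C \<in> F" "C \<noteq> A" "x \<in> C" "x \<in> A" "t * pw B x < 0"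
  shows False
proof -
  obtain p where p: "p \<in> A" "p \<in> B" using meets AB by blast
  have "pw B p = 0" using p pw_0[OF AB(2)] by blast
  then have xp: "x \<noteq> p" using x(5) by auto
  have "x \<in> vertices F" "p \<in> vertices F" unfolding vertices_def using x p AB by blast+
  then have ev: "e \<subseteq> A - {p, x}" using e(2) by blast
  have oU: "open {z. t * pw B z < 0}" by (intro open_Collect_less continuous_intros)
  have "A \<inter> {z. t * pw B z < 0} \<subseteq> closure e"
  proof
    fix y assume y: "y \<in> A \<inter> {z. t * pw B z < 0}"
    then have "y \<in> frontier f" using sector_frontier_points[OF f(1,2) AB(1,4)] by blast
    moreover have "closure e' \<subseteq> B" using e(3) closed_circle[OF circ[OF AB(2)]] by (rule closure_minimal)
    moreover have "y \<notin> B" using y pw_0[OF AB(2), of y] by auto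
    ultimately show "y \<in> closure e" using f(3) by blast
  qed
  then show False
    using arc_not_across[OF circ[OF AB(1)] p(1) x(4) xp e(1) ev oU] x(5) by blast
qed

text \<open>If the edges lie on different circles, another circle meets neither the open face, nor
  both boundary circles at one point by simplicity, nor a bounding arc by \<open>arc_free\<close>.
  If they lie on the same circle, the face is a whole side of it.\<close>

lemma digon_cases:
  assumes f: "f \<in> digons F"
  shows "(\<exists>A s B t e e'. A \<in> F \<and> B \<in> F \<and> A \<noteq> B \<and> empty_lens A s B t \<and> f = sector A s B t \<and>
      e \<in> components (A - vertices F) \<and> e' \<in> components (B - vertices F) \<and>
      frontier f = closure e \<union> closure e') \<or> (\<exists>A. disc_digon f A)"
proof -
  note face = digon_face[OF f]
  obtain e1 e2 where e: "e1 \<in> edges F" "e2 \<in> edges F" "e1 \<noteq> e2" and fr: "frontier f = closure e1 \<union> closure e2"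
    using f unfolding digons_def by blast
  obtain A B where AB: "A \<in> F" "B \<in> F" and e1: "e1 \<in> components (A - vertices F)" and e2: "e2 \<in> components (B - vertices F)"
    using e unfolding edges_def by blast
  have sub: "e1 \<subseteq> A - vertices F" "e2 \<subseteq> B - vertices F" and con: "connected e1" "connected e2"
    using e1 e2 in_components_subset in_components_connected by blast+
  have "closure e1 \<subseteq> A" by (rule closure_minimal) (use sub closed_circle[OF circ] AB in blast)+
  moreover have "closure e2 \<subseteq> B" by (rule closure_minimal) (use sub closed_circle[OF circ] AB in blast)+
  ultimately have frs: "frontier f \<subseteq> A \<union> B" using fr by blast
  have "A \<noteq> {}" using circ_par(1)[OF circ[OF AB(1)]] circle_cent_rad[OF circ[OF AB(1)]]
    by (metis less_eq_real_def sphere_eq_empty not_less)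
  then obtain p where p: "p \<in> A" "p \<in> B" using meets AB by (cases "A = B") blast+
  obtain s t where st: "s = 1 \<or> s = - 1" "t = 1 \<or> t = - 1" and fs: "f = sector A s B t"
    using face_eq_sector[OF circ _ AB p frs] f unfolding digons_def by blast
  show ?thesis
  proof (cases "A = B")
    case True
    have "s = t" using face(2) st fs True by (auto simp: sector_def)
    have "A \<subseteq> frontier f"
    proof
      fix y assume y: "y \<in> A"
      have "y \<in> closure f"
        unfolding closure_iff_nhds_not_empty
      proof (intro allI impI)
        fix N T assume "T \<subseteq> N" "open T" "y \<in> T"
        then obtain z where "z \<in> T" "s * pw A z < 0" using near_side[OF circ[OF AB(1)] y, of T s] st by blast
        then show "f \<inter> N \<noteq> {}" using \<open>T \<subseteq> N\<close> fs True \<open>s = t\<close> by (auto simp: sector_def)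
      qed
      moreover have "y \<notin> f" using face(3) y AB(1) by blast
      ultimately show "y \<in> frontier f" using fs open_sector by (auto simp: frontier_def interior_open)
    qed
    then have "disc_digon f A"
      unfolding disc_digon_def using f AB(1) st fs True \<open>s = t\<close> e(3) e1 e2 fr by blast
    then show ?thesis by blast
  next
    case False
    have "empty_lens A s B t"
      unfolding empty_lens_def
    proof (intro conjI ballI impI notI)
      fix C x assume C: "C \<in> F" "C \<noteq> A" "C \<noteq> B" "x \<in> C" and le: "s * pw A x \<le> 0 \<and> t * pw B x \<le> 0"
      have "x \<notin> f" using C face(3) by blast
      then have "\<not> (s * pw A x < 0 \<and> t * pw B x < 0)" by (simp add: fs sector_def)
      then consider "pw A x = 0" "pw B x = 0" | "pw A x = 0" "t * pw B x < 0" | "pw B x = 0" "s * pw A x < 0"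
        using le st by force
      then show False
      proof cases
        case 1 then show False using no_triple[OF AB(1,2) C(1) False] C pw_0 AB by blast
      next
        case 2
        then have "x \<in> A" using pw_0 AB by blast
        then show False
          using arc_free[OF face(3) fs fr AB False st(1) con(1) sub(1) _ C(1,2,4) _ 2(2)] sub(2) by blast
      next
        case 3
        then have "x \<in> B" using pw_0 AB by blast
        then show False
          using arc_free[OF face(3) fs[unfolded sector_commute[of A]] fr[unfolded Un_commute[of "closure e1"]]
              AB(2,1) _ st(2) con(2) sub(2) _ C(1,3,4) _ 3(2)] sub(1) False by blast
      qed
    qed (use AB False st in auto)
    then show ?thesis using AB False fs e1 e2 fr by blast
  qed
qed

section \<open>Which digons can share a circle\<close>

lemma third:
  assumes "3 \<le> card F"
  shows "\<exists>C\<in>F. C \<noteq> A \<and> C \<noteq> B"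
proof (rule ccontr)
  assume "\<not> ?thesis"
  then have "F \<subseteq> {A, B}" by blast
  then have "card F \<le> card {A, B}" by (rule card_mono[rotated]) simp
  also have "\<dots> \<le> 2" by (simp add: card_insert_if)
  finally show False using assms by simp
qed

lemma empty_lensD:
  assumes "empty_lens A s B t"
  shows "A \<in> F" "B \<in> F" "A \<noteq> B" "s = 1 \<or> s = - 1" "t = 1 \<or> t = - 1"
    and "\<And>C x. C \<in> F \<Longrightarrow> C \<noteq> A \<Longrightarrow> C \<noteq> B \<Longrightarrow> x \<in> C \<Longrightarrow> s * pw A x \<le> 0 \<Longrightarrow> t * pw B x \<le> 0 \<Longrightarrow> False"
  using assms unfolding empty_lens_def by blast+

text \<open>Take a point common to \<open>B\<close> and \<open>B'\<close>, or to \<open>B\<close>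
  and a third circle if \<open>B = B'\<close>. For each lens it is on a foreign circle and satisfies
  the inequality of \<open>B\<close> or \<open>B'\<close> with equality, so emptiness puts it
  strictly off both chosen sides of \<open>A\<close>; these cannot be opposite.\<close>

lemma empty_lens_side:
  assumes l: "empty_lens A s B t" and l': "empty_lens A s' B' t'" and n: "3 \<le> card F"
  shows "s = s'"
proof (rule ccontr)
  assume "s \<noteq> s'"
  note E = empty_lensD[OF l] and E' = empty_lensD[OF l']
  have s': "s' = - s" using E(4) E'(4) \<open>s \<noteq> s'\<close> by auto
  have out: "\<exists>x. \<not> s * pw A x \<le> 0 \<and> \<not> s' * pw A x \<le> 0"
  proof (cases "B = B'")
    case True
    obtain Y where Y: "Y \<in> F" "Y \<noteq> A" "Y \<noteq> B" using third[OF n, of A B] by blast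
    obtain y where y: "y \<in> Y" "y \<in> B" using meets[OF Y(1) E(2) Y(3)] by blast
    have "pw B y = 0" using y(2) pw_0[OF E(2)] by simp
    then show ?thesis using E(6)[OF Y y(1)] E'(6)[OF Y(1,2) _ y(1)] Y(3) True by auto
  next
    case False
    obtain x where x: "x \<in> B" "x \<in> B'" using meets[OF E(2) E'(2) False] by blast
    have "pw B x = 0" "pw B' x = 0" using x pw_0[OF E(2)] pw_0[OF E'(2)] by simp_all
    then show ?thesis
      using E(6)[OF E'(2) _ _ x(2)] E'(6)[OF E(2) _ _ x(1)] E(3) E'(3) False by auto
  qed
  then show False using s' by auto
qed

lemma disc_digonD:
  assumes "disc_digon f A"
  shows "f \<in> digons F" "A \<in> F" "\<exists>s. (s = 1 \<or> s = - 1) \<and> f = sector A s A s"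
  using assms unfolding disc_digon_def by simp_all

text \<open>On the same side of \<open>A\<close>, the lens and \<open>f\<close> are one face, and a
  point of a third circle on \<open>A\<close> is in the closed lens. On opposite sides, a point of a
  third circle on \<open>B\<close> is not in \<open>f\<close>, hence in the closed lens.\<close>

lemma disc_digon_no_lens:
  assumes d: "disc_digon f A" and l: "empty_lens A s B t" and n: "3 \<le> card F"
    and f': "sector A s B t \<in> digons F"
  shows False
proof -
  note E = empty_lensD[OF l]
  note fd = disc_digonD(1)[OF d]
  obtain s' where s': "s' = 1 \<or> s' = - 1" and fs: "f = sector A s' A s'"
    using disc_digonD(3)[OF d] by blast
  obtain Y where Y: "Y \<in> F" "Y \<noteq> A" "Y \<noteq> B" using third[OF n, of A B] by blast
  show False
  proof (cases "s' = s")
    case True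
    have "sector A s B t \<subseteq> f" unfolding fs True by (auto simp: sector_def)
    then have eq: "sector A s B t = f"
      using components_eq[OF digon_face(1)[OF f'] digon_face(1)[OF fd]] digon_face(2)[OF f'] by blast
    obtain y where y: "y \<in> Y" "y \<in> A" using meets[OF Y(1) E(1) Y(2)] by blast
    have "y \<in> closure f"
      unfolding closure_iff_nhds_not_empty
    proof (intro allI impI)
      fix N T assume "T \<subseteq> N" "open T" "y \<in> T"
      then obtain z where "z \<in> T" "s' * pw A z < 0"
        using near_side[OF circ[OF E(1)] y(2), of T s'] s' by blast
      then show "f \<inter> N \<noteq> {}" using \<open>T \<subseteq> N\<close> unfolding fs by (auto simp: sector_def)
    qed
    then have "s * pw A y \<le> 0 \<and> t * pw B y \<le> 0"
      using frontier_sector(2)[OF circ[OF E(1)] circ[OF E(2)], of s t] eq by auto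
    then show False using E(6)[OF Y y(1)] by simp
  next
    case False
    then have ss: "s' = - s" using E(4) s' by auto
    obtain y where y: "y \<in> Y" "y \<in> B" using meets[OF Y(1) E(2) Y(3)] by blast
    have "y \<notin> f" using digon_face(3)[OF fd] y(1) Y(1) by blast
    then have "s * pw A y \<le> 0" unfolding fs ss sector_def by simp
    moreover have "pw B y = 0" using y(2) pw_0[OF E(2)] by simp
    ultimately show False using E(6)[OF Y y(1)] by simp
  qed
qed

text \<open>If both sides of \<open>A\<close> were faces, a common point of two other circles would
  have to be on \<open>A\<close>, a triple point.\<close>

lemma disc_digon_unique:
  assumes f: "disc_digon f A" and g: "disc_digon g A" and n: "3 \<le> card F"
  shows "f = g"
proof (rule ccontr)
  assume ne: "f \<noteq> g"
  obtain s where s1: "s = 1 \<or> s = - 1" "f = sector A s A s" using disc_digonD(3)[OF f] by blast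
  obtain s' where s2: "s' = 1 \<or> s' = - 1" "g = sector A s' A s'" using disc_digonD(3)[OF g] by blast
  have "s \<noteq> s'" using ne s1(2) s2(2) by metis
  then have ss: "s' = - s" using s1(1) s2(1) by linarith
  obtain C where C: "C \<in> F" "C \<noteq> A" using third[OF n, of A A] by blast
  obtain D where D: "D \<in> F" "D \<noteq> A" "D \<noteq> C" using third[OF n, of A C] by blast
  obtain x where x: "x \<in> C" "x \<in> D" using meets[OF C(1) D(1)] D(3) by blast
  have "x \<notin> f" using digon_face(3)[OF disc_digonD(1)[OF f]] x(1) C(1) by blast
  then have 1: "\<not> s * pw A x < 0" unfolding s1(2) sector_def by simp
  have "x \<notin> g" using digon_face(3)[OF disc_digonD(1)[OF g]] x(1) C(1) by blast
  then have 2: "\<not> s' * pw A x < 0" unfolding s2(2) sector_def by simp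
  have "pw A x = 0" using s1(1) 1 2 unfolding ss by auto
  then have "x \<in> A" using pw_0[OF disc_digonD(2)[OF f]] by simp
  then show False
    using no_triple[OF disc_digonD(2)[OF f] C(1) D(1)] C(2) D(2,3) x by metis
qed

text \<open>With four circles, simplicity gives three different vertices on \<open>A\<close>, too
  many for two edges.\<close>

lemma no_disc_digon:
  assumes "disc_digon f A" and n: "4 \<le> card F"
  shows False
proof -
  obtain e e' where A: "A \<in> F" and e: "e \<in> components (A - vertices F)" "e' \<in> components (A - vertices F)"
    and cover: "A \<subseteq> closure e \<union> closure e'"
    using assms unfolding disc_digon_def by blast
  have "3 \<le> card (F - {A})" using n A fin by simp
  then obtain T where T: "T \<subseteq> F - {A}" "card T = 3"
    by (rule obtain_subset_with_card_n)
  then obtain B C D where BCD: "T = {B, C, D}" "B \<noteq> C" "B \<noteq> D" "C \<noteq> D"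
    unfolding card_3_iff by blast
  have BCD': "B \<in> F" "B \<noteq> A" "C \<in> F" "C \<noteq> A" "D \<in> F" "D \<noteq> A" using T BCD by auto
  obtain x where x: "x \<in> A" "x \<in> B" using meets[of A B] A BCD' by blast
  obtain y where y: "y \<in> A" "y \<in> C" using meets[of A C] A BCD' by blast
  obtain z where z: "z \<in> A" "z \<in> D" using meets[of A D] A BCD' by blast
  note v = x y z
  have ne: "x \<noteq> y" "x \<noteq> z" "y \<noteq> z"
    using no_triple[of A B C x] no_triple[of A B D x] no_triple[of A C D y] A BCD BCD' v by metis+
  have "x \<in> vertices F" "y \<in> vertices F" "z \<in> vertices F"
    unfolding vertices_def using A BCD' v by blast+
  then have "e \<subseteq> A - {x, y, z}" "e' \<subseteq> A - {x, y, z}" "connected e" "connected e'"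
    using in_components_subset in_components_connected e by blast+
  then show False
    using two_arcs_three_points[OF circ[OF A] v(1,3,5) ne] cover by blast
qed

end

section \<open>Stereographic projection\<close>

definition stereo :: "complex \<Rightarrow> complex \<times> real" where
  "stereo z = ((2 / ((norm z)\<^sup>2 + 1)) *\<^sub>R z, ((norm z)\<^sup>2 - 1) / ((norm z)\<^sup>2 + 1))"

lemma norm_stereo: "norm (stereo z) = 1"
proof -
  define m where "m = (norm z)\<^sup>2 + 1"
  have m: "m > 0" unfolding m_def by (simp add: add_nonneg_pos)
  have zz: "z \<bullet> z = m - 1" and e: "(norm z)\<^sup>2 - 1 = m - 2" by (simp_all add: m_def dot_square_norm)
  have "stereo z \<bullet> stereo z = (2 / m) * (2 / m) * (m - 1) + (m - 2) / m * ((m - 2) / m)"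
    unfolding stereo_def m_def[symmetric] e inner_Pair inner_scaleR_left inner_scaleR_right zz by simp
  also have "\<dots> = (4 * (m - 1) + (m - 2) * (m - 2)) / (m * m)" by (simp add: add_divide_distrib)
  also have "4 * (m - 1) + (m - 2) * (m - 2) = m * m" by (simp add: algebra_simps)
  finally show ?thesis using m by (simp add: norm_eq_sqrt_inner)
qed

lemma stereo_surj:
  assumes "norm x = 1" "x \<noteq> (0, 1)"
  shows "\<exists>z. x = stereo z"
proof -
  obtain u a where x: "x = (u, a)" by (cases x)
  have 1: "(norm u)\<^sup>2 + a\<^sup>2 = 1" using assms(1) by (simp add: x norm_prod_def)
  have "a \<noteq> 1" using assms(2) 1 by (auto simp: x)
  moreover have "a \<le> 1"
  proof -
    have "a\<^sup>2 \<le> 1" using 1 zero_le_power2[of "norm u"] by linarith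
    then have "\<bar>a\<bar> \<le> 1" by (simp only: abs_square_le_1)
    then show ?thesis by simp
  qed
  ultimately have a: "1 - a > 0" by simp
  define z where "z = (1 / (1 - a)) *\<^sub>R u"
  have "(norm z)\<^sup>2 = (1 - a\<^sup>2) / (1 - a)\<^sup>2" using 1 a by (simp add: z_def power_divide)
  also have "\<dots> = (1 + a) / (1 - a)"
  proof -
    have "1 - a\<^sup>2 = (1 + a) * (1 - a)" by (simp add: power2_eq_square algebra_simps)
    then show ?thesis using a by (simp add: power2_eq_square)
  qed
  finally have n: "(norm z)\<^sup>2 = (1 + a) / (1 - a)" .
  have n1: "(norm z)\<^sup>2 + 1 = 2 / (1 - a)" "(norm z)\<^sup>2 - 1 = 2 * a / (1 - a)"
    unfolding n using a by (simp_all add: field_simps)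
  have "x = stereo z" unfolding x stereo_def n1 using a by (simp add: z_def)
  then show ?thesis by blast
qed

text \<open>The power of the origin, which is the constant term in the equation of the
  circle.\<close>

definition ipow :: "complex set \<Rightarrow> real" where
  "ipow A = (norm (cent A))\<^sup>2 - (rad A)\<^sup>2"

definition nrm :: "complex set \<Rightarrow> real" where
  "nrm A = sqrt (4 * (norm (cent A))\<^sup>2 + (ipow A - 1)\<^sup>2)"

text \<open>The circle lifts to the section of the sphere by the plane with normal
  \<open>(2 * cent A, ipow A - 1)\<close> and offset \<open>1 + ipow A\<close>. Division by
  \<open>nrm A\<close> makes these the centre and the cosine of the angular radius; \<open>s\<close>
  picks one of the two complementary caps.\<close>

definition cap_center :: "complex set \<Rightarrow> real \<Rightarrow> complex \<times> real" where
  "cap_center A s = (s / nrm A) *\<^sub>R (2 * cent A, ipow A - 1)"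

definition cap_height :: "complex set \<Rightarrow> real \<Rightarrow> real" where
  "cap_height A s = s * (1 + ipow A) / nrm A"

text \<open>The squares differ by \<open>4 * (rad A)\<^sup>2\<close>, so the plane cuts the sphere
  in a proper circle.\<close>

lemma nrm_gt:
  assumes "is_circle A"
  shows "\<bar>1 + ipow A\<bar> < nrm A"
proof -
  have "(1 + ipow A)\<^sup>2 < 4 * (norm (cent A))\<^sup>2 + (ipow A - 1)\<^sup>2"
    using circle_cent_rad(1)[OF assms] unfolding ipow_def by (simp add: power2_eq_square algebra_simps)
  then have "\<bar>1 + ipow A\<bar>\<^sup>2 < 4 * (norm (cent A))\<^sup>2 + (ipow A - 1)\<^sup>2" by simp
  then show ?thesis unfolding nrm_def by (rule real_less_rsqrt)
qed

lemma cap_height_bounds: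
  assumes "is_circle A" "s = 1 \<or> s = - 1"
  shows "\<bar>cap_height A s\<bar> < 1"
  using nrm_gt[OF assms(1)] assms(2) by (auto simp: cap_height_def abs_mult)

lemma norm_cap_center:
  assumes "is_circle A" "s = 1 \<or> s = - 1"
  shows "norm (cap_center A s) = 1"
proof -
  have "norm (2 * cent A, ipow A - 1) = nrm A"
    by (simp add: norm_prod_def nrm_def norm_mult power_mult_distrib)
  then have "norm (cap_center A s) = \<bar>s / nrm A\<bar> * nrm A" by (simp only: cap_center_def norm_scaleR)
  then show ?thesis using nrm_gt[OF assms(1)] assms(2) by (auto simp: abs_mult)
qed

lemma stereo_cap:
  assumes "is_circle A"
  shows "stereo z \<bullet> cap_center A s - cap_height A s = - (2 * s * pw A z) / (nrm A * ((norm z)\<^sup>2 + 1))"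
proof -
  define m where "m = (norm z)\<^sup>2 + 1"
  have m: "m > 0" unfolding m_def by (simp add: add_nonneg_pos)
  have n: "nrm A > 0" using nrm_gt[OF assms] by linarith
  have p: "pw A z = m - 1 - 2 * (z \<bullet> cent A) + ipow A"
    unfolding pw_def ipow_def m_def cmod_power2 by (simp add: inner_complex_def power2_eq_square algebra_simps)
  have "stereo z \<bullet> cap_center A s = (s / nrm A) * ((2 / m) * (2 * (z \<bullet> cent A)) + ((m - 2) / m) * (ipow A - 1))"
  proof -
    have "(norm z)\<^sup>2 - 1 = m - 2" by (simp add: m_def)
    moreover have "z \<bullet> (2 * cent A) = 2 * (z \<bullet> cent A)" by (simp add: inner_complex_def)
    ultimately show ?thesis
      unfolding stereo_def cap_center_def m_def[symmetric] inner_scaleR_right inner_Pair inner_scaleR_left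
      by simp
  qed
  also have "\<dots> - cap_height A s = - (2 * s * pw A z) / (nrm A * m)"
  proof -
    have "s / nrm A * (2 / m * (2 * c) + (m - 2) / m * (q - 1)) - s * (1 + q) / nrm A
      = - (2 * s * (m - 1 - 2 * c + q)) / (nrm A * m)" for c q
    proof -
      have 1: "2 / m * (2 * c) + (m - 2) / m * (q - 1) = (4 * c + (m - 2) * (q - 1)) / m"
        by (simp add: add_divide_distrib)
      have 2: "s * (1 + q) / nrm A = s / nrm A * ((1 + q) * m / m)" using m by simp
      have 3: "(4 * c + (m - 2) * (q - 1)) - (1 + q) * m = - (2 * (m - 1 - 2 * c + q))"
        by (simp add: algebra_simps)
      have 4: "s / nrm A * (- (2 * x) / m) = - (2 * s * x) / (nrm A * m)" for x by simp
      show ?thesis unfolding 1 2 right_diff_distrib[symmetric] diff_divide_distrib[symmetric] 3 by (rule 4)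
    qed
    then show ?thesis unfolding p cap_height_def .
  qed
  finally show ?thesis by (simp add: m_def)
qed

lemma stereo_cap_iff:
  assumes "is_circle A" "s = 1 \<or> s = - 1"
  shows "stereo z \<bullet> cap_center A s = cap_height A s \<longleftrightarrow> z \<in> A"
    and "cap_height A s \<le> stereo z \<bullet> cap_center A s \<longleftrightarrow> s * pw A z \<le> 0"
proof -
  have n: "0 < nrm A * ((norm z)\<^sup>2 + 1)" using nrm_gt[OF assms(1)] by (intro mult_pos_pos add_nonneg_pos) auto
  have e: "stereo z \<bullet> cap_center A s = cap_height A s + - (2 * s * pw A z) / (nrm A * ((norm z)\<^sup>2 + 1))"
    using stereo_cap[OF assms(1), of z s] by linarith
  have "stereo z \<bullet> cap_center A s = cap_height A s \<longleftrightarrow> - (2 * s * pw A z) / (nrm A * ((norm z)\<^sup>2 + 1)) = 0"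
    unfolding e by linarith
  also have "\<dots> \<longleftrightarrow> pw A z = 0" using n assms(2) by (auto simp del: mult_eq_0_iff simp: divide_eq_0_iff)
  also have "\<dots> \<longleftrightarrow> z \<in> A" using circle_iff_pw[OF assms(1)] by blast
  finally show "stereo z \<bullet> cap_center A s = cap_height A s \<longleftrightarrow> z \<in> A" .
  have "cap_height A s \<le> stereo z \<bullet> cap_center A s \<longleftrightarrow> 0 \<le> - (2 * s * pw A z) / (nrm A * ((norm z)\<^sup>2 + 1))"
    unfolding e by linarith
  also have "\<dots> \<longleftrightarrow> 0 \<le> - (2 * s * pw A z)" using n by (rule pos_le_divide_eq[THEN trans]) simp
  also have "\<dots> \<longleftrightarrow> s * pw A z \<le> 0" by linarith
  finally show "cap_height A s \<le> stereo z \<bullet> cap_center A s \<longleftrightarrow> s * pw A z \<le> 0" .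
qed

text \<open>The north pole, the one point that \<open>stereo\<close> misses, is on no lifted circle:
  there the plane equation would read \<open>ipow A - 1 = ipow A + 1\<close>.\<close>

lemma circle_point_stereo:
  assumes "is_circle A" "s = 1 \<or> s = - 1" "norm x = 1" "x \<bullet> cap_center A s = cap_height A s"
  shows "\<exists>z. x = stereo z"
proof (rule stereo_surj[OF assms(3)])
  show "x \<noteq> (0, 1)"
  proof
    assume "x = (0, 1)"
    then have "s / nrm A * (ipow A - 1) = s * (1 + ipow A) / nrm A"
      using assms(4) by (simp add: cap_center_def cap_height_def)
    then show False using nrm_gt[OF assms(1)] assms(2) by auto
  qed
qed

section \<open>The number of digons\<close>

context circle_arrangement
begin

lemma card_lens_digons:
  assumes n: "3 \<le> card F"
  shows "finite lens_digons \<and> card lens_digons \<le> 2 * card F - 2"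
proof -
  \<comment> \<open>By \<open>empty_lens_side\<close> all witnesses give the same sign; the value is
    arbitrary for circles without an empty lens.\<close>
  define sg where "sg A = (SOME s. \<exists>B t. empty_lens A s B t)" for A
  have sg: "sg A = s" if l: "empty_lens A s B t" for A s B t
  proof -
    have "\<exists>B t. empty_lens A (sg A) B t" unfolding sg_def by (rule someI_ex) (use l in blast)
    then show ?thesis using empty_lens_side[OF _ l n] by blast
  qed
  define E where "E = {(A, B). empty_lens A (sg A) B (sg B)}"
  \<comment> \<open>Circles without a lens have no well-defined side and would give isolated
    vertices, so they are left out.\<close>
  define I where "I = {A \<in> F. \<exists>B. (A, B) \<in> E}"
  have EF: "A \<in> F" "B \<in> F" "A \<noteq> B" "(B, A) \<in> E" if "(A, B) \<in> E" for A B
    using that empty_lensD(1-3)[of A "sg A" B "sg B"] empty_lens_commute[of A "sg A" B "sg B"] by (auto simp: E_def)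
  have "finite I" using fin by (simp add: I_def)
  have "E \<subseteq> F \<times> F" using EF by auto
  then have finE: "finite E" using fin finite_subset by blast
  have sgI: "sg A = 1 \<or> sg A = - 1" if "A \<in> I" for A
    using that empty_lensD(4) unfolding I_def E_def by blast
  have circI: "is_circle A" if "A \<in> I" for A using that circ by (simp add: I_def)
  have cosr: "cos (arccos (cap_height A (sg A))) = cap_height A (sg A)" if "A \<in> I" for A
    using cap_height_bounds[OF circI sgI, OF that that] by (intro cos_arccos) auto
  have meet: "\<exists>x. norm x = 1 \<and> x \<bullet> cap_center A (sg A) = cap_height A (sg A) \<and>
      x \<bullet> cap_center B (sg B) = cap_height B (sg B)" if "A \<in> I" "B \<in> I" "A \<noteq> B" for A B
  proof -
    have "A \<inter> B \<noteq> {}" using meets that by (simp add: I_def)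
    then obtain z where "z \<in> A" "z \<in> B" by blast
    then show ?thesis using norm_stereo stereo_cap_iff(1)[OF circI sgI] that by blast
  qed
  have indep: "cap_center A (sg A) \<noteq> k *\<^sub>R cap_center B (sg B)"
    if AB: "A \<in> I" "B \<in> I" "A \<noteq> B" and k: "k = 1 \<or> k = - 1" for A B k
  proof
    assume eq: "cap_center A (sg A) = k *\<^sub>R cap_center B (sg B)"
    obtain x where x: "x \<bullet> cap_center A (sg A) = cap_height A (sg A)" "x \<bullet> cap_center B (sg B) = cap_height B (sg B)"
      using meet[OF AB] by blast
    then have h: "cap_height A (sg A) = k * cap_height B (sg B)" by (simp add: eq)
    have "z \<in> A \<longleftrightarrow> z \<in> B" for z
      unfolding stereo_cap_iff(1)[OF circI sgI, OF AB(1,1), symmetric]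
        stereo_cap_iff(1)[OF circI sgI, OF AB(2,2), symmetric] eq h using k by auto
    then show False using AB(3) by blast
  qed
  have caps: "caps I (\<lambda>A. cap_center A (sg A)) (\<lambda>A. arccos (cap_height A (sg A))) E"
  proof
    show "norm (cap_center A (sg A)) = 1" if "A \<in> I" for A
      using norm_cap_center[OF circI sgI] that by blast
    show "0 < arccos (cap_height A (sg A)) \<and> arccos (cap_height A (sg A)) < pi" if "A \<in> I" for A
      using cap_height_bounds[OF circI sgI, OF that that] arccos_lt_bounded by auto
    show "cap_center A (sg A) \<noteq> cap_center B (sg B) \<and> cap_center A (sg A) \<noteq> - cap_center B (sg B)"
      if "A \<in> I" "B \<in> I" "A \<noteq> B" for A B
      using indep[OF that, of 1] indep[OF that, of "- 1"] by simp
    show "\<exists>x. norm x = 1 \<and> x \<bullet> cap_center A (sg A) = cos (arccos (cap_height A (sg A))) \<and>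
        x \<bullet> cap_center B (sg B) = cos (arccos (cap_height B (sg B)))"
      if "A \<in> I" "B \<in> I" "A \<noteq> B" for A B
      using meet[OF that] cosr that by simp
    show "E \<subseteq> I \<times> I"
    proof (rule subrelI)
      fix A B assume AB: "(A, B) \<in> E"
      show "(A, B) \<in> I \<times> I" using EF(1,2,4)[OF AB] AB by (auto simp: I_def)
    qed
    show "(B, A) \<in> E" if "(A, B) \<in> E" for A B using EF that by blast
    show "(A, A) \<notin> E" for A using EF by blast
    show False if AB: "(A, B) \<in> E" and C: "C \<in> I" "C \<noteq> A" "C \<noteq> B" and x: "norm x = 1"
      "x \<bullet> cap_center C (sg C) = cos (arccos (cap_height C (sg C)))"
      "cos (arccos (cap_height A (sg A))) \<le> x \<bullet> cap_center A (sg A)"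
      "cos (arccos (cap_height B (sg B))) \<le> x \<bullet> cap_center B (sg B)" for A B C x
    proof -
      have I: "A \<in> I" "B \<in> I" using EF(1,2,4)[OF AB] AB by (auto simp: I_def)
      have xC: "x \<bullet> cap_center C (sg C) = cap_height C (sg C)" using x(2) cosr[OF C(1)] by simp
      obtain z where z: "x = stereo z" using circle_point_stereo[OF circI sgI x(1) xC] C by blast
      have "z \<in> C" using xC stereo_cap_iff(1)[OF circI sgI] C unfolding z by blast
      moreover have "sg A * pw A z \<le> 0" "sg B * pw B z \<le> 0"
        using x(3,4) stereo_cap_iff(2)[OF circI sgI, of A A z] stereo_cap_iff(2)[OF circI sgI, of B B z] I cosr
        unfolding z by auto
      ultimately show False
        using empty_lensD(6)[of A "sg A" B "sg B" C z] AB C by (simp add: E_def I_def)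
    qed
  qed
  define g where "g f = (SOME e. e \<in> E \<and> f = sector (fst e) (sg (fst e)) (snd e) (sg (snd e)))" for f
  have g: "g f \<in> E \<and> f = sector (fst (g f)) (sg (fst (g f))) (snd (g f)) (sg (snd (g f)))" if f: "f \<in> lens_digons" for f
  proof -
    obtain A s B t where l: "empty_lens A s B t" "f = sector A s B t" using f unfolding lens_digons_def by blast
    have s: "sg A = s" "sg B = t" using sg l(1) empty_lens_commute by blast+
    have "\<exists>e. e \<in> E \<and> f = sector (fst e) (sg (fst e)) (snd e) (sg (snd e))"
      by (rule exI[of _ "(A, B)"]) (use l s in \<open>simp add: E_def\<close>)
    then show ?thesis unfolding g_def by (rule someI_ex)
  qed
  \<comment> \<open>The Boolean selects one of the two orders of the pair, so each lens digon
    accounts for two elements of \<open>E\<close>.\<close>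
  let ?h = "\<lambda>(f, b). if b then g f else prod.swap (g f)"
  have inj: "inj_on ?h (lens_digons \<times> UNIV)"
  proof (rule inj_onI)
    fix x y assume x: "x \<in> lens_digons \<times> UNIV" and y: "y \<in> lens_digons \<times> UNIV" and eq: "?h x = ?h y"
    obtain f b f' b' where xy: "x = (f, b)" "y = (f', b')" by (cases x, cases y)
    have gf: "g f \<in> E" "g f' \<in> E" using x y xy g by auto
    have cases: "g f = g f' \<and> b = b' \<or> g f = prod.swap (g f') \<and> b \<noteq> b'"
      using eq unfolding xy by (auto split: if_splits simp: prod_eq_iff)
    then have "f = f'"
    proof
      assume "g f = g f' \<and> b = b'"
      then show ?thesis using g x y xy by (metis mem_Sigma_iff)
    next
      assume a: "g f = prod.swap (g f') \<and> b \<noteq> b'"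
      have "f = sector (snd (g f')) (sg (snd (g f'))) (fst (g f')) (sg (fst (g f')))"
        using g[of f] x xy a by simp
      also have "\<dots> = f'" using g[of f'] y xy sector_commute by simp
      finally show ?thesis .
    qed
    moreover have "g f \<noteq> prod.swap (g f)" using EF(3) gf(1) by (cases "g f") auto
    ultimately show "x = y" using cases xy by auto
  qed
  have sub: "?h ` (lens_digons \<times> UNIV) \<subseteq> E"
  proof (rule image_subsetI)
    fix x assume "x \<in> lens_digons \<times> (UNIV :: bool set)"
    then obtain f b where "x = (f, b)" "f \<in> lens_digons" by auto
    then show "?h x \<in> E" using g[of f] EF(4)[of "fst (g f)" "snd (g f)"] by (cases "g f") auto
  qed
  have "finite (lens_digons \<times> (UNIV :: bool set))" using inj_on_finite[OF inj sub finE] .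
  then have fl: "finite lens_digons" using finite_cartesian_productD1 by blast
  have "card (lens_digons \<times> (UNIV :: bool set)) \<le> card E" using card_inj_on_le[OF inj sub finE] .
  then have two: "2 * card lens_digons \<le> card E" by (simp add: card_cartesian_product)
  have "card lens_digons \<le> 2 * card F - 2"
  proof (cases "I = {}")
    case True
    have "E = {}"
    proof (rule equals0I)
      fix e assume e: "e \<in> E"
      then have "fst e \<in> I" using EF(1)[of "fst e" "snd e"] by (auto simp: I_def intro: exI[of _ "snd e"])
      then show False using True by simp
    qed
    then show ?thesis using two by simp
  next
    case False
    \<comment> \<open>With \<open>two\<close>, twice the number of lens digons is at most
      \<open>4 * card F - 3\<close>; by parity it is at most \<open>4 * card F - 4\<close>.\<close>
    have "card E + 3 \<le> 4 * card I"
      by (rule card_cap_edges[OF caps \<open>finite I\<close> False]) (simp add: I_def)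
    moreover have "card I \<le> card F" using fin by (intro card_mono) (auto simp: I_def)
    ultimately show ?thesis using two by linarith
  qed
  then show ?thesis using fl by blast
qed


lemma digon_lens_or_disc:
  "f \<in> digons F \<Longrightarrow> f \<in> lens_digons \<or> (\<exists>A. disc_digon f A)"
  using digon_cases[of f] unfolding lens_digons_def by blast

section \<open>Small families and the combination of all cases\<close>

text \<open>Four is three plus one: each circle bounds at most one disc digon, and a lens cannot use
  \<open>A\<close>, so it belongs to the other two circles, whose sides are determined.\<close>

lemma card_digons_three:
  assumes n: "card F = 3" and d: "disc_digon f A"
  shows "finite (digons F) \<and> card (digons F) \<le> 4"
proof -
  have n3: "3 \<le> card F" using n by simp
  note AF = disc_digonD(2)[OF d]
  have "card (F - {A}) = 2" using n fin AF by simp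
  then obtain B C where BC: "F - {A} = {B, C}" "B \<noteq> C" unfolding card_2_iff by blast
  have one: "g = g'" if g: "g \<in> lens_digons" "g' \<in> lens_digons" for g g'
  proof -
    have other: "\<exists>s t. empty_lens B s C t \<and> x = sector B s C t" if x: "x \<in> lens_digons" for x
    proof -
      obtain X s Y t where l: "empty_lens X s Y t" "x = sector X s Y t" and xd: "x \<in> digons F"
        using x unfolding lens_digons_def by blast
      have l': "empty_lens Y t X s" "x = sector Y t X s"
        using empty_lens_commute[OF l(1)] l(2) sector_commute[of X s Y t] by simp_all
      have "X \<noteq> A" using disc_digon_no_lens[OF d _ n3, of s Y t] l xd by auto
      moreover have "Y \<noteq> A" using disc_digon_no_lens[OF d _ n3, of t X s] l' xd by auto
      ultimately have "X \<in> {B, C}" "Y \<in> {B, C}" using empty_lensD(1,2)[OF l(1)] unfolding BC(1)[symmetric] by simp_all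
      then have "X = B \<and> Y = C \<or> X = C \<and> Y = B" using empty_lensD(3)[OF l(1)] by auto
      then show ?thesis using l l' by auto
    qed
    obtain s t where 1: "empty_lens B s C t" "g = sector B s C t" using other[OF g(1)] by blast
    obtain s' t' where 2: "empty_lens B s' C t'" "g' = sector B s' C t'" using other[OF g(2)] by blast
    have "s = s'" using empty_lens_side[OF 1(1) 2(1) n3] .
    moreover have "t = t'" using empty_lens_side[OF empty_lens_commute empty_lens_commute n3, OF 1(1) 2(1)] .
    ultimately show ?thesis using 1 2 by simp
  qed
  define D where "D = {g. \<exists>A. disc_digon g A}"
  define a where "a g = (SOME A. disc_digon g A)" for g
  have a: "disc_digon g (a g)" if "g \<in> D" for g
    using that unfolding a_def D_def by (simp add: someI_ex)
  have inj: "inj_on a D"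
  proof (rule inj_onI)
    fix g g' assume "g \<in> D" "g' \<in> D" "a g = a g'"
    then show "g = g'" using disc_digon_unique[OF a[of g] _ n3] a[of g'] by simp
  qed
  have sub: "a ` D \<subseteq> F" using a disc_digonD(2) by blast
  have "finite D" "card D \<le> 3"
    using inj_on_finite[OF inj sub fin] card_inj_on_le[OF inj sub fin] n by simp_all
  moreover have "finite lens_digons" using card_lens_digons[OF n3] by blast
  moreover have "card lens_digons \<le> 1"
    using one calculation(3) by (simp add: card_le_Suc0_iff_eq)
  moreover have "digons F \<subseteq> lens_digons \<union> D" using digon_lens_or_disc unfolding D_def by blast
  ultimately show ?thesis
    using finite_subset[of "digons F" "lens_digons \<union> D"] card_mono[of "lens_digons \<union> D" "digons F"]
      card_Un_le[of lens_digons D] by simp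
qed

lemma card_digons_ge_3:
  assumes n: "3 \<le> card F"
  shows "finite (digons F) \<and> card (digons F) \<le> 2 * card F - 2"
proof (cases "\<exists>f A. disc_digon f A")
  case True
  then obtain f A where d: "disc_digon f A" by blast
  have "\<not> 4 \<le> card F" using no_disc_digon[OF d] by blast
  then have "card F = 3" using n by linarith
  then show ?thesis using card_digons_three[OF _ d] by simp
next
  case False
  then have "digons F = lens_digons" using digon_lens_or_disc unfolding lens_digons_def by blast
  then show ?thesis using card_lens_digons[OF n] by simp
qed

text \<open>\<open>A\<close> without the common point is connected and misses \<open>B\<close>, so
  the power with respect to \<open>B\<close> keeps its sign on it.\<close>

lemma tangent_side:
  assumes AB: "A \<in> F" "B \<in> F" and x: "A \<inter> B = {x}"
    and y: "y \<in> A - {x}" "y' \<in> A - {x}" "t * pw B y \<le> 0" "t' * pw B y' \<le> 0"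
    and t: "t = 1 \<or> t = - 1" "t' = 1 \<or> t' = - 1"
  shows "t = t'"
proof (rule ccontr)
  assume "t \<noteq> t'"
  have "x \<in> A" using x by blast
  then have "connected (pw B ` (A - {x}))"
    by (intro connected_continuous_image continuous_intros connected_circle_minus_point[OF circ[OF AB(1)]])
  moreover have nz: "0 \<notin> pw B ` (A - {x})" using pw_0[OF AB(2)] x by force
  ultimately have no: "\<not> (u \<in> pw B ` (A - {x}) \<and> v \<in> pw B ` (A - {x}) \<and> u \<le> 0 \<and> 0 \<le> v)" for u v
    unfolding connected_iff_interval by blast
  have "pw B y \<in> pw B ` (A - {x})" "pw B y' \<in> pw B ` (A - {x})" using y by auto
  then show False using no[of "pw B y" "pw B y'"] no[of "pw B y'" "pw B y"] y(3,4) t \<open>t \<noteq> t'\<close> by auto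
qed

text \<open>Non-triviality makes the circles tangent, so each carries a single edge. The boundary of
  a digon contains both edges, and by \<open>tangent_side\<close> this fixes both signs of its
  region.\<close>

lemma card_digons_two:
  assumes n: "card F = 2" and nt: "\<not> trivial_arrangement F"
  shows "finite (digons F) \<and> card (digons F) \<le> 1"
proof -
  obtain A B where F: "F = {A, B}" "A \<noteq> B" using n unfolding card_2_iff by blast
  have AB: "A \<in> F" "B \<in> F" using F by auto
  obtain x where "x \<in> A \<inter> B" using meets[OF AB F(2)] by blast
  moreover have "p = q" if "p \<in> A \<inter> B" "q \<in> A \<inter> B" for p q
    using nt that F unfolding trivial_arrangement_def by blast
  ultimately have x: "A \<inter> B = {x}" by blast
  then have V: "vertices F = {x}" using F unfolding vertices_def by blast
  have single: "connected (C - vertices F)" if "C \<in> F" for C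
    unfolding V by (rule connected_circle_minus_point[OF circ[OF that]]) (use that F x in blast)
  have no_disc: "\<not> disc_digon f C" for f C
  proof
    assume "disc_digon f C"
    then obtain e e' where C: "C \<in> F" and e: "e \<noteq> e'" "e \<in> components (C - vertices F)" "e' \<in> components (C - vertices F)"
      unfolding disc_digon_def by blast
    have "C - vertices F \<noteq> {}"
      using in_components_nonempty[OF e(2)] in_components_subset[OF e(2)] by blast
    then have "components (C - vertices F) = {C - vertices F}"
      using single[OF C] by (simp add: components_eq_sing_iff)
    then show False using e by simp
  qed
  have shape: "\<exists>s t y y'. (s = 1 \<or> s = - 1) \<and> (t = 1 \<or> t = - 1) \<and> f = sector A s B t \<and>
      y \<in> A - {x} \<and> t * pw B y \<le> 0 \<and> y' \<in> B - {x} \<and> s * pw A y' \<le> 0" if f: "f \<in> digons F" for f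
  proof -
    obtain C s D t e e' where l: "C \<in> F" "D \<in> F" "C \<noteq> D" "empty_lens C s D t" "f = sector C s D t"
      and e: "e \<in> components (C - vertices F)" "e' \<in> components (D - vertices F)"
      and fr: "frontier f = closure e \<union> closure e'"
      using digon_cases[OF f] no_disc by blast
    obtain y where y: "y \<in> e" using in_components_nonempty[OF e(1)] by blast
    obtain y' where y': "y' \<in> e'" using in_components_nonempty[OF e(2)] by blast
    have yC: "y \<in> C - {x}" "y' \<in> D - {x}" using in_components_subset e y y' V by blast+
    have "y \<in> closure f" "y' \<in> closure f"
      using y y' fr closure_subset unfolding frontier_def by blast+
    then have le: "s * pw C y \<le> 0 \<and> t * pw D y \<le> 0" "s * pw C y' \<le> 0 \<and> t * pw D y' \<le> 0"
      using frontier_sector(2)[OF circ[OF l(1)] circ[OF l(2)], of s t] l(5) by blast+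
    note st = empty_lensD(4,5)[OF l(4)]
    have "C = A \<and> D = B \<or> C = B \<and> D = A" using l(1-3) F by blast
    then show ?thesis
    proof
      assume "C = A \<and> D = B"
      then show ?thesis using st l(5) yC le by blast
    next
      assume "C = B \<and> D = A"
      then show ?thesis using st l(5) yC le sector_commute[of C s D t] by blast
    qed
  qed
  have "f = g" if fg: "f \<in> digons F" "g \<in> digons F" for f g
  proof -
    obtain s t y y' where 1: "s = 1 \<or> s = - 1" "t = 1 \<or> t = - 1" "f = sector A s B t"
      "y \<in> A - {x}" "t * pw B y \<le> 0" "y' \<in> B - {x}" "s * pw A y' \<le> 0" using shape[OF fg(1)] by blast
    obtain s' t' z z' where 2: "s' = 1 \<or> s' = - 1" "t' = 1 \<or> t' = - 1" "g = sector A s' B t'"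
      "z \<in> A - {x}" "t' * pw B z \<le> 0" "z' \<in> B - {x}" "s' * pw A z' \<le> 0" using shape[OF fg(2)] by blast
    have "t = t'" by (rule tangent_side[OF AB x 1(4) 2(4) 1(5) 2(5) 1(2) 2(2)])
    moreover have "B \<inter> A = {x}" using x by blast
    then have "s = s'" by (rule tangent_side[OF AB(2,1) _ 1(6) 2(6) 1(7) 2(7) 1(1) 2(1)])
    ultimately show ?thesis using 1(3) 2(3) by simp
  qed
  then show ?thesis
  proof (cases "digons F = {}")
    case False
    then obtain f where "f \<in> digons F" by blast
    then have "digons F = {f}" using \<open>\<And>f g. f \<in> digons F \<Longrightarrow> g \<in> digons F \<Longrightarrow> f = g\<close> by blast
    then show ?thesis by simp
  qed simp
qed

lemma card_ge_2:
  assumes nt: "\<not> trivial_arrangement F"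
  shows "2 \<le> card F"
proof (rule ccontr)
  assume "\<not> ?thesis"
  then have "card F = 0 \<or> card F = 1" by linarith
  then have "F = {} \<or> (\<exists>A. F = {A})" using fin by (auto simp: card_1_singleton_iff)
  then obtain A where A: "F \<subseteq> {A}" by blast
  show False
  proof (cases "F = {}")
    case True
    then show False using nt unfolding trivial_arrangement_def by (metis empty_iff zero_neq_one)
  next
    case False
    then have F: "F = {A}" using A by blast
    then have cA: "is_circle A" using circ by blast
    obtain c r where cr: "r > 0" "A = sphere c r" using cA unfolding is_circle_def by blast
    have "c + of_real r \<in> A" "c - of_real r \<in> A" "c + of_real r \<noteq> c - of_real r"
      using cr by (auto simp: dist_norm)
    then show False using nt F unfolding trivial_arrangement_def by blast
  qed
qed

end

theorem theorem1:
  fixes F :: "complex set set" and n :: nat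
  assumes "finite F" and "card F = n"
    and "\<And>C. C \<in> F \<Longrightarrow> is_circle C"
    and "\<And>A B. A \<in> F \<Longrightarrow> B \<in> F \<Longrightarrow> A \<noteq> B \<Longrightarrow> A \<inter> B \<noteq> {}"
    and "simple_arrangement F"
    and "\<not> trivial_arrangement F"
  shows "finite (digons F) \<and> card (digons F) \<le> 2 * n - 2"
proof -
  interpret circle_arrangement F
    using assms by unfold_locales
  show ?thesis
  proof (cases "3 \<le> card F")
    case True
    then show ?thesis using card_digons_ge_3 assms(2) by simp
  next
    case False
    then have "card F = 2" using card_ge_2[OF assms(6)] by simp
    then show ?thesis using card_digons_two[OF _ assms(6)] assms(2) by simp
  qed
qed

end
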